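(* Let the initial condition be $\psi=0$ and the nonlinearity $F\equiv0$, so that the mild solution of $\partial_tu=\Delta u+\xi$ on $[0,\infty)\times\mathbb T$ and its explicit finite difference approximation are $$u_t(x)=\int_0^t\int_{\mathbb T}p_{t-s}(x,y)\,\xi(dy,ds),\qquad u^n_t(x)=\int_0^t\int_{\mathbb T}p^n_{\kappa_n(t-s)}(x,\rho_n(y))\,\xi(dy,ds)\quad(x\in\Pi_n).$$ Then for any $\varepsilon>0$ and $t>0$ one has $$n^{1+\varepsilon}\,\big|\langle\delta u_t-u^n_t,\delta e_1\rangle_n\big|\ \underset{n\to\infty}{\longrightarrow}\ \infty\quad\text{in probability},$$ i.e. for every $M>0$, $\mathbb P\big(n^{1+\varepsilon}|\langle\delta u_t-u^n_t,\delta e_1\rangle_n|>M\big)\to1$ as $n\to\infty$.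
   Context: $\mathbb T=\mathbb R/\mathbb Z$. $\xi$ is a space-time white noise on $[0,\infty)\times\mathbb T$ on a complete probability space: a map from bounded Borel sets to $L_2(\Omega)$ such that $(\xi(A_1),\dots,\xi(A_k))$ is always centred Gaussian with covariance $\mathbb E(\xi(A_i)\xi(A_j))=|A_i\cap A_j|$; integrals against $\xi$ are the corresponding Wiener integrals. $e_j(x)=e^{2\pi ijx}$, and $p_t(x,y)=\sum_{j\in\mathbb Z}e^{-4\pi^2j^2t}e_j(x-y)$ for $t>0$. Fix $c\in(0,1/4)$. For an integer $n\ge1$ put $h=c(2n)^{-2}$, $\Pi_n=\{0,(2n)^{-1},\dots,(2n-1)(2n)^{-1}\}\subset\mathbb T$, $\Lambda_n=\{0,h,2h,\dots\}$, $\kappa_n(t)=\lfloor th^{-1}\rfloor h$, $\rho_n(x)=\lfloor 2nx\rfloor(2n)^{-1}$ (for $x\in[0,1)$), $\lambda^n_j=-16n^2\sin^2\big(\frac{j\pi}{2n}\big)$, and for $t\in\Lambda_n$, $x,y\in\Pi_n$, $p^n_t(x,y)=\sum_{j=-n}^{n-1}(1+h\lambda^n_j)^{t/h}e_j(x-y)$. For $t\in\Lambda_n$, $u^n_t$ coincides with the solution of the explicit scheme $u^n_0=0$, $u^n_{t+h}(x)=u^n_t(x)+h\Delta_nu^n_t(x)+2n\,\xi([t,t+h]\times[x,x+(2n)^{-1}])$, where $\Delta_nf(x)=(2n)^2(f(x+(2n)^{-1})-2f(x)+f(x-(2n)^{-1}))$; for other $t\ge0$ it is defined by the integral formula in the claim.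 $\delta$ denotes restriction of continuous functions on $\mathbb T$ to $\Pi_n$, and $\langle f,g\rangle_n=\frac1{2n}\sum_{x\in\Pi_n}f(x)\overline{g(x)}$. *)

theory Defs
  imports "HOL-Probability.Probability"
begin

section \<open>Space-time white noise and Wiener integrals\<close>

text \<open>The torus is represented by its fundamental domain \<open>{0..<1}\<close>, and a point of space-time is a
  pair (time, space).\<close>

definition spacetime :: "(real \<times> real) set" where
  "spacetime = {0..} \<times> {0..<1}"

definition bounded_borel :: "(real \<times> real) set set" where
  "bounded_borel = {A \<in> sets borel. bounded A \<and> A \<subseteq> spacetime}"

text \<open>Degenerate (almost surely vanishing) variables count as normal.\<close>

definition centred_normal :: "'w measure \<Rightarrow> ('w \<Rightarrow> real) \<Rightarrow> bool" where
  "centred_normal P X \<longleftrightarrow>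
     X \<in> borel_measurable P \<and>
     ((AE \<omega> in P. X \<omega> = 0) \<or> (\<exists>\<sigma>>0. distributed P lborel X (normal_density 0 \<sigma>)))"

definition centred_gaussian_vector :: "'w measure \<Rightarrow> nat \<Rightarrow> (nat \<Rightarrow> 'w \<Rightarrow> real) \<Rightarrow> bool" where
  "centred_gaussian_vector P k X \<longleftrightarrow>
     (\<forall>a :: nat \<Rightarrow> real. centred_normal P (\<lambda>\<omega>. \<Sum>i<k. a i * X i \<omega>))"

definition white_noise :: "'w measure \<Rightarrow> ((real \<times> real) set \<Rightarrow> 'w \<Rightarrow> real) \<Rightarrow> bool" where
  "white_noise P \<xi> \<longleftrightarrow>
     (\<forall>A\<in>bounded_borel. \<xi> A \<in> borel_measurable P \<and> integrable P (\<lambda>\<omega>. (\<xi> A \<omega>)\<^sup>2)) \<and>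
     (\<forall>k (A :: nat \<Rightarrow> (real \<times> real) set). (\<forall>i<k. A i \<in> bounded_borel) \<longrightarrow>
        centred_gaussian_vector P k (\<lambda>i. \<xi> (A i)) \<and>
        (\<forall>i<k. \<forall>j<k.
           (LINT \<omega>|P. \<xi> (A i) \<omega> * \<xi> (A j) \<omega>) = measure lborel (A i \<inter> A j)))"

text \<open>\<open>W\<close> is the integral against \<open>\<xi>\<close> of the step function \<open>g\<close>.\<close>

definition elementary_integral ::
  "((real \<times> real) set \<Rightarrow> 'w \<Rightarrow> real) \<Rightarrow> (real \<times> real \<Rightarrow> complex) \<Rightarrow> ('w \<Rightarrow> complex) \<Rightarrow> bool" where
  "elementary_integral \<xi> g W \<longleftrightarrow>
     (\<exists>(k :: nat) (a :: nat \<Rightarrow> complex) A. (\<forall>i<k. A i \<in> bounded_borel) \<and>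
        g = (\<lambda>z. \<Sum>i<k. a i * indicator (A i) z) \<and>
        W = (\<lambda>\<omega>. \<Sum>i<k. a i * complex_of_real (\<xi> (A i) \<omega>)))"

text \<open>\<open>I\<close> is a version of the Wiener integral of the square-integrable function \<open>f\<close>, that is, an
  \<open>L\<^sub>2\<close>-limit of elementary integrals of step functions converging to \<open>f\<close> in \<open>L\<^sub>2\<close>.  By the Ito
  isometry, versions agree almost surely.  Nonnegative integrals are used for the distances because
  the Bochner integral of a non-integrable function is 0.\<close>

definition wiener_integral ::
  "'w measure \<Rightarrow> ((real \<times> real) set \<Rightarrow> 'w \<Rightarrow> real) \<Rightarrow> (real \<times> real \<Rightarrow> complex) \<Rightarrow> ('w \<Rightarrow> complex) \<Rightarrow> bool"
  where
  "wiener_integral P \<xi> f I \<longleftrightarrow>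
     f \<in> borel_measurable borel \<and> I \<in> borel_measurable P \<and>
     (\<exists>g W. (\<forall>m :: nat. elementary_integral \<xi> (g m) (W m)) \<and>
        (\<lambda>m. \<integral>\<^sup>+ z. ennreal ((cmod (f z - g m z))\<^sup>2) \<partial>lborel) \<longlonglongrightarrow> 0 \<and>
        (\<lambda>m. \<integral>\<^sup>+ \<omega>. ennreal ((cmod (I \<omega> - W m \<omega>))\<^sup>2) \<partial>P) \<longlonglongrightarrow> 0)"

section \<open>Mild solution of the stochastic heat equation\<close>

definition fourier :: "int \<Rightarrow> real \<Rightarrow> complex" where
  "fourier j x = exp (2 * of_real pi * \<i> * of_int j * of_real x)"

definition heat_kernel :: "real \<Rightarrow> real \<Rightarrow> real \<Rightarrow> complex" where
  "heat_kernel t x y =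
     (\<Sum>\<^sub>\<infinity>j\<in>(UNIV :: int set).
        of_real (exp (- 4 * pi\<^sup>2 * (of_int j)\<^sup>2 * t)) * fourier j (x - y))"

text \<open>The solution is a real random field, each value of which may be any version of the stochastic
  integral; the kernels are real-valued, although written with complex exponentials.  The time
  interval is half-open so that the heat kernel is evaluated at positive times only.\<close>

definition mild_solution ::
  "'w measure \<Rightarrow> ((real \<times> real) set \<Rightarrow> 'w \<Rightarrow> real) \<Rightarrow> (real \<Rightarrow> real \<Rightarrow> 'w \<Rightarrow> real) \<Rightarrow> bool" where
  "mild_solution P \<xi> u \<longleftrightarrow>
     (\<forall>t\<ge>0. \<forall>x\<in>{0..<1}.
        wiener_integral P \<xi>
          (\<lambda>(s, y). indicator ({0..<t} \<times> {0..<1}) (s, y) * heat_kernel (t - s) x y)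
          (\<lambda>\<omega>. complex_of_real (u t x \<omega>)))"

section \<open>Explicit finite difference approximation\<close>

definition time_step :: "real \<Rightarrow> nat \<Rightarrow> real" where
  "time_step c n = c / (2 * real n)\<^sup>2"

definition grid :: "nat \<Rightarrow> real set" where
  "grid n = (\<lambda>k. real k / (2 * real n)) ` {..<2 * n}"

definition kappa :: "real \<Rightarrow> nat \<Rightarrow> real \<Rightarrow> real" where
  "kappa c n t = of_int \<lfloor>t / time_step c n\<rfloor> * time_step c n"

definition rho :: "nat \<Rightarrow> real \<Rightarrow> real" where
  "rho n x = of_int \<lfloor>2 * real n * x\<rfloor> / (2 * real n)"

definition discrete_eigenvalue :: "nat \<Rightarrow> int \<Rightarrow> real" where
  "discrete_eigenvalue n j = - 16 * (real n)\<^sup>2 * (sin (of_int j * pi / (2 * real n)))\<^sup>2"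

text \<open>The base of the power is positive for \<open>0 < c < 1/4\<close> and \<open>n \<ge> 1\<close>, so \<open>powr\<close> is the usual power;
  the exponent is a natural number at the grid times.\<close>

definition discrete_kernel :: "real \<Rightarrow> nat \<Rightarrow> real \<Rightarrow> real \<Rightarrow> real \<Rightarrow> complex" where
  "discrete_kernel c n t x y =
     (\<Sum>j = - int n..int n - 1.
        of_real ((1 + time_step c n * discrete_eigenvalue n j) powr (t / time_step c n))
          * fourier j (x - y))"

definition fd_approximation ::
  "'w measure \<Rightarrow> ((real \<times> real) set \<Rightarrow> 'w \<Rightarrow> real) \<Rightarrow> real \<Rightarrow> nat \<Rightarrow> (real \<Rightarrow> real \<Rightarrow> 'w \<Rightarrow> real) \<Rightarrow> bool"
  where
  "fd_approximation P \<xi> c n v \<longleftrightarrow>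
     (\<forall>t\<ge>0. \<forall>x\<in>grid n.
        wiener_integral P \<xi>
          (\<lambda>(s, y). indicator ({0..<t} \<times> {0..<1}) (s, y)
             * discrete_kernel c n (kappa c n (t - s)) x (rho n y))
          (\<lambda>\<omega>. complex_of_real (v t x \<omega>)))"

definition grid_restrict :: "nat \<Rightarrow> (real \<Rightarrow> complex) \<Rightarrow> real \<Rightarrow> complex" where
  "grid_restrict n f = restrict f (grid n)"

definition grid_inner :: "nat \<Rightarrow> (real \<Rightarrow> complex) \<Rightarrow> (real \<Rightarrow> complex) \<Rightarrow> complex" where
  "grid_inner n f g = 1 / (2 * of_nat n) * (\<Sum>x\<in>grid n. f x * cnj (g x))"

end

theory Submission imports Defs "HOL-Real_Asymp.Real_Asymp" begin

text \<open>Since \<open>u\<close> and \<open>u\<^sup>n\<close> are real, the real part of the inner product is itself a real Wiener integral,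
  of the kernel difference averaged against \<open>cos (2 \<pi> x)\<close> over the grid.  Its variance is at least of
  order \<open>n\<^sup>-\<^sup>2\<close>: on each time slice, the discrete kernel depends on the space variable only through \<open>\<rho>\<^sub>n\<close>,
  and rounding the mode 1 creates a component of size about \<open>1 / (2 n + 1)\<close> in the mode \<open>2 n + 1\<close>, where
  the heat kernel is exponentially small.  A centred normal variable with standard deviation at least
  \<open>\<sigma>\<close> has mass at most \<open>\<delta> / \<sigma>\<close> in \<open>[-\<delta>, \<delta>]\<close>, which for \<open>\<delta>\<close> of order \<open>n\<close> to the power \<open>-1 - \<epsilon>\<close> tends
  to 0.\<close>

section \<open>Wiener integrals\<close>

text \<open>Looking for the error in mode 1 itself would be awkward: there the coefficients of the
  two kernels are nearly equal, and a lower bound would have to quantify what survives their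
  cancellation. Mode \<open>2 * n + 1\<close> is an alias of mode 1 on the grid, so the average
  against the cosine sees it with the fixed weight 1/2, while the tiny heat coefficient cannot
  cancel the discrete one. The heat coefficient is small only away from time 0. Hence only the noise
  from times \<open>s \<le> t / 2\<close> is counted, for which \<open>t - s \<ge> t / 2\<close>;
  discarding the rest only lowers the bound on the variance. Passing to the real part is harmless,
  since it is dominated by the modulus, and it leads to the scalar normal variables for which a
  large variance alone excludes concentration near 0.\<close>

lemma power2_norm_add_le:
  fixes a b :: "'a::real_normed_vector"
  shows "(norm (a + b))\<^sup>2 \<le> 2 * (norm a)\<^sup>2 + 2 * (norm b)\<^sup>2"
proof -
  have "(norm (a + b))\<^sup>2 \<le> (norm a + norm b)\<^sup>2"
    by (intro power_mono norm_triangle_ineq) auto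
  also have "\<dots> \<le> 2 * (norm a)\<^sup>2 + 2 * (norm b)\<^sup>2"
    using sum_squares_bound[of "norm a" "norm b"] by (simp add: power2_sum)
  finally show ?thesis .
qed

lemma nn_integral_power2_norm_add_le:
  fixes f g :: "'a \<Rightarrow> complex"
  assumes [measurable]: "f \<in> borel_measurable M" "g \<in> borel_measurable M"
  shows "(\<integral>\<^sup>+ x. ennreal ((cmod (f x + g x))\<^sup>2) \<partial>M) \<le>
    2 * (\<integral>\<^sup>+ x. ennreal ((cmod (f x))\<^sup>2) \<partial>M) + 2 * (\<integral>\<^sup>+ x. ennreal ((cmod (g x))\<^sup>2) \<partial>M)"
proof -
  have "(\<integral>\<^sup>+ x. ennreal ((cmod (f x + g x))\<^sup>2) \<partial>M) \<le>
    (\<integral>\<^sup>+ x. 2 * ennreal ((cmod (f x))\<^sup>2) + 2 * ennreal ((cmod (g x))\<^sup>2) \<partial>M)"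
  proof (intro nn_integral_mono)
    fix x
    have "ennreal ((cmod (f x + g x))\<^sup>2) \<le> ennreal (2 * (cmod (f x))\<^sup>2 + 2 * (cmod (g x))\<^sup>2)"
      by (intro ennreal_leI power2_norm_add_le)
    also have "\<dots> = 2 * ennreal ((cmod (f x))\<^sup>2) + 2 * ennreal ((cmod (g x))\<^sup>2)"
      by (simp add: ennreal_mult)
    finally show "ennreal ((cmod (f x + g x))\<^sup>2) \<le>
      2 * ennreal ((cmod (f x))\<^sup>2) + 2 * ennreal ((cmod (g x))\<^sup>2)" .
  qed
  also have "\<dots> = 2 * (\<integral>\<^sup>+ x. ennreal ((cmod (f x))\<^sup>2) \<partial>M) + 2 * (\<integral>\<^sup>+ x. ennreal ((cmod (g x))\<^sup>2) \<partial>M)"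
    by (simp add: nn_integral_add nn_integral_cmult)
  finally show ?thesis .
qed

lemma elementary_integral_measurable:
  assumes "white_noise P \<xi>" "elementary_integral \<xi> g W"
  shows "g \<in> borel_measurable borel" "W \<in> borel_measurable P"
proof -
  from assms(2) obtain k a A where A: "\<And>i. i < k \<Longrightarrow> A i \<in> bounded_borel"
    and g: "g = (\<lambda>z. \<Sum>i<(k::nat). a i * indicator (A i) z)"
    and W: "W = (\<lambda>\<omega>. \<Sum>i<k. a i * complex_of_real (\<xi> (A i) \<omega>))"
    unfolding elementary_integral_def by blast
  have "A i \<in> sets borel" "\<xi> (A i) \<in> borel_measurable P" if "i < k" for i
    using A[OF that] assms(1) by (auto simp: bounded_borel_def white_noise_def)
  then show "g \<in> borel_measurable borel" "W \<in> borel_measurable P"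
    unfolding g W
    by (intro borel_measurable_sum borel_measurable_times borel_measurable_const
        borel_measurable_indicator borel_measurable_of_real; simp)+
qed

text \<open>The sets of a representation may overlap, so two step functions are added by
  concatenating their representations.\<close>

lemma elementary_integral_add:
  assumes "elementary_integral \<xi> g W" "elementary_integral \<xi> g' W'"
  shows "elementary_integral \<xi> (\<lambda>z. g z + g' z) (\<lambda>\<omega>. W \<omega> + W' \<omega>)"
proof -
  from assms(1) obtain k a A where A: "\<And>i. i < k \<Longrightarrow> A i \<in> bounded_borel"
    and g: "g = (\<lambda>z. \<Sum>i<(k::nat). a i * indicator (A i) z)"
    and W: "W = (\<lambda>\<omega>. \<Sum>i<k. a i * complex_of_real (\<xi> (A i) \<omega>))"
    unfolding elementary_integral_def by blast
  from assms(2) obtain k' a' A' where A': "\<And>i. i < k' \<Longrightarrow> A' i \<in> bounded_borel"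
    and g': "g' = (\<lambda>z. \<Sum>i<(k'::nat). a' i * indicator (A' i) z)"
    and W': "W' = (\<lambda>\<omega>. \<Sum>i<k'. a' i * complex_of_real (\<xi> (A' i) \<omega>))"
    unfolding elementary_integral_def by blast
  let ?a = "\<lambda>i. if i < k then a i else a' (i - k)" and ?A = "\<lambda>i. if i < k then A i else A' (i - k)"
  \<comment> \<open>\<open>F\<close> will be an indicator in one use and the noise in the other, so
    one index computation serves the step function and its integral.\<close>
  have split: "(\<Sum>i<k + k'. ?a i * F (?A i)) = (\<Sum>i<k. a i * F (A i)) + (\<Sum>i<k'. a' i * F (A' i))"
    for F :: "(real \<times> real) set \<Rightarrow> complex"
    by (induction k') (auto simp: algebra_simps)
  show ?thesis
    unfolding elementary_integral_def
  proof (intro exI conjI)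
    show "\<forall>i<k + k'. ?A i \<in> bounded_borel" using A A' by auto
    show "(\<lambda>z. g z + g' z) = (\<lambda>z. \<Sum>i<k + k'. ?a i * indicator (?A i) z)"
      using split[of "\<lambda>A. indicator A _"] by (simp add: g g' fun_eq_iff)
    show "(\<lambda>\<omega>. W \<omega> + W' \<omega>) = (\<lambda>\<omega>. \<Sum>i<k + k'. ?a i * complex_of_real (\<xi> (?A i) \<omega>))"
      using split[of "\<lambda>A. complex_of_real (\<xi> A _)"] by (simp add: W W' fun_eq_iff)
  qed
qed

lemma elementary_integral_cmult:
  assumes "elementary_integral \<xi> g W"
  shows "elementary_integral \<xi> (\<lambda>z. b * g z) (\<lambda>\<omega>. b * W \<omega>)"
proof -
  from assms obtain k a A where A: "\<And>i. i < k \<Longrightarrow> A i \<in> bounded_borel"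
    and g: "g = (\<lambda>z. \<Sum>i<(k::nat). a i * indicator (A i) z)"
    and W: "W = (\<lambda>\<omega>. \<Sum>i<k. a i * complex_of_real (\<xi> (A i) \<omega>))"
    unfolding elementary_integral_def by blast
  show ?thesis
    unfolding elementary_integral_def g W
    by (rule exI[of _ k], rule exI[of _ "\<lambda>i. b * a i"], rule exI[of _ A])
       (simp add: A sum_distrib_left mult.assoc del: sum_mult_indicator)
qed

lemma wiener_integral_add:
  assumes wn: "white_noise P \<xi>"
    and "wiener_integral P \<xi> f X" "wiener_integral P \<xi> f' X'"
  shows "wiener_integral P \<xi> (\<lambda>z. f z + f' z) (\<lambda>\<omega>. X \<omega> + X' \<omega>)"
proof -
  \<comment> \<open>Stated for an arbitrary measure because it is applied twice: to kernels under
    \<open>lborel\<close> and to random variables under \<open>P\<close>.\<close>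
  have limit: "(\<lambda>m. \<integral>\<^sup>+ x. ennreal ((cmod (F x + F' x - (G m x + G' m x)))\<^sup>2) \<partial>M) \<longlonglongrightarrow> 0"
    if [measurable]: "F \<in> borel_measurable M" "F' \<in> borel_measurable M"
      "\<And>m. G m \<in> borel_measurable M" "\<And>m. G' m \<in> borel_measurable M"
      and lim: "(\<lambda>m. \<integral>\<^sup>+ x. ennreal ((cmod (F x - G m x))\<^sup>2) \<partial>M) \<longlonglongrightarrow> 0"
        "(\<lambda>m. \<integral>\<^sup>+ x. ennreal ((cmod (F' x - G' m x))\<^sup>2) \<partial>M) \<longlonglongrightarrow> 0"
    for M :: "'b measure" and F F' :: "'b \<Rightarrow> complex" and G G' :: "nat \<Rightarrow> 'b \<Rightarrow> complex"
  proof (rule tendsto_sandwich[OF _ _ tendsto_const])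
    show "\<forall>\<^sub>F m in sequentially. (\<integral>\<^sup>+ x. ennreal ((cmod (F x + F' x - (G m x + G' m x)))\<^sup>2) \<partial>M)
      \<le> 2 * (\<integral>\<^sup>+ x. ennreal ((cmod (F x - G m x))\<^sup>2) \<partial>M)
        + 2 * (\<integral>\<^sup>+ x. ennreal ((cmod (F' x - G' m x))\<^sup>2) \<partial>M)"
      using nn_integral_power2_norm_add_le[of "\<lambda>x. F x - G _ x" M "\<lambda>x. F' x - G' _ x"]
      by (intro always_eventually allI) (simp add: algebra_simps)
    show "(\<lambda>m. 2 * (\<integral>\<^sup>+ x. ennreal ((cmod (F x - G m x))\<^sup>2) \<partial>M)
        + 2 * (\<integral>\<^sup>+ x. ennreal ((cmod (F' x - G' m x))\<^sup>2) \<partial>M)) \<longlonglongrightarrow> 0"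
      using tendsto_add[OF ennreal_tendsto_cmult[OF _ lim(1), of 2] ennreal_tendsto_cmult[OF _ lim(2), of 2]]
      by simp
  qed auto
  from assms(2) obtain g W where 1: "f \<in> borel_measurable borel" "X \<in> borel_measurable P"
      "\<And>m. elementary_integral \<xi> (g m) (W m)"
      "(\<lambda>m. \<integral>\<^sup>+ z. ennreal ((cmod (f z - g m z))\<^sup>2) \<partial>lborel) \<longlonglongrightarrow> 0"
      "(\<lambda>m. \<integral>\<^sup>+ \<omega>. ennreal ((cmod (X \<omega> - W m \<omega>))\<^sup>2) \<partial>P) \<longlonglongrightarrow> 0"
    unfolding wiener_integral_def by blast
  from assms(3) obtain g' W' where 2: "f' \<in> borel_measurable borel" "X' \<in> borel_measurable P"
      "\<And>m. elementary_integral \<xi> (g' m) (W' m)"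
      "(\<lambda>m. \<integral>\<^sup>+ z. ennreal ((cmod (f' z - g' m z))\<^sup>2) \<partial>lborel) \<longlonglongrightarrow> 0"
      "(\<lambda>m. \<integral>\<^sup>+ \<omega>. ennreal ((cmod (X' \<omega> - W' m \<omega>))\<^sup>2) \<partial>P) \<longlonglongrightarrow> 0"
    unfolding wiener_integral_def by blast
  note meas = elementary_integral_measurable[OF wn 1(3)] elementary_integral_measurable[OF wn 2(3)]
  show ?thesis
    unfolding wiener_integral_def
  proof (intro conjI exI allI)
    show "elementary_integral \<xi> (\<lambda>z. g m z + g' m z) (\<lambda>\<omega>. W m \<omega> + W' m \<omega>)" for m
      by (intro elementary_integral_add 1 2)
    show "(\<lambda>m. \<integral>\<^sup>+ z. ennreal ((cmod (f z + f' z - (g m z + g' m z)))\<^sup>2) \<partial>lborel) \<longlonglongrightarrow> 0"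
      using 1 2 meas by (intro limit) auto
    show "(\<lambda>m. \<integral>\<^sup>+ \<omega>. ennreal ((cmod (X \<omega> + X' \<omega> - (W m \<omega> + W' m \<omega>)))\<^sup>2) \<partial>P) \<longlonglongrightarrow> 0"
      using 1 2 meas by (intro limit) auto
    show "(\<lambda>z. f z + f' z) \<in> borel_measurable borel" "(\<lambda>\<omega>. X \<omega> + X' \<omega>) \<in> borel_measurable P"
      using 1(1,2) 2(1,2) by (simp_all only: borel_measurable_add)
  qed
qed

lemma wiener_integral_cmult:
  assumes wn: "white_noise P \<xi>" and "wiener_integral P \<xi> f X"
  shows "wiener_integral P \<xi> (\<lambda>z. b * f z) (\<lambda>\<omega>. b * X \<omega>)"
proof -
  from assms(2) obtain g W where 1: "f \<in> borel_measurable borel" "X \<in> borel_measurable P"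
      "\<And>m. elementary_integral \<xi> (g m) (W m)"
      "(\<lambda>m. \<integral>\<^sup>+ z. ennreal ((cmod (f z - g m z))\<^sup>2) \<partial>lborel) \<longlonglongrightarrow> 0"
      "(\<lambda>m. \<integral>\<^sup>+ \<omega>. ennreal ((cmod (X \<omega> - W m \<omega>))\<^sup>2) \<partial>P) \<longlonglongrightarrow> 0"
    unfolding wiener_integral_def by blast
  have limit: "(\<lambda>m. \<integral>\<^sup>+ x. ennreal ((cmod (b * F x - b * G m x))\<^sup>2) \<partial>M) \<longlonglongrightarrow> 0"
    if [measurable]: "F \<in> borel_measurable M" "\<And>m. G m \<in> borel_measurable M"
      and lim: "(\<lambda>m. \<integral>\<^sup>+ x. ennreal ((cmod (F x - G m x))\<^sup>2) \<partial>M) \<longlonglongrightarrow> 0"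
    for M :: "'b measure" and F :: "'b \<Rightarrow> complex" and G :: "nat \<Rightarrow> 'b \<Rightarrow> complex"
  proof -
    have "(\<integral>\<^sup>+ x. ennreal ((cmod (b * F x - b * G m x))\<^sup>2) \<partial>M)
        = ennreal ((cmod b)\<^sup>2) * (\<integral>\<^sup>+ x. ennreal ((cmod (F x - G m x))\<^sup>2) \<partial>M)" for m
      by (subst nn_integral_cmult[symmetric])
         (auto simp: right_diff_distrib[symmetric] norm_mult power_mult_distrib ennreal_mult)
    then show ?thesis
      using ennreal_tendsto_cmult[OF _ lim, of "ennreal ((cmod b)\<^sup>2)"] by simp
  qed
  note meas = elementary_integral_measurable[OF wn 1(3)]
  show ?thesis
    unfolding wiener_integral_def
  proof (intro conjI exI allI)
    show "elementary_integral \<xi> (\<lambda>z. b * g m z) (\<lambda>\<omega>. b * W m \<omega>)" for m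
      by (intro elementary_integral_cmult 1)
    show "(\<lambda>m. \<integral>\<^sup>+ z. ennreal ((cmod (b * f z - b * g m z))\<^sup>2) \<partial>lborel) \<longlonglongrightarrow> 0"
      using 1 meas by (intro limit) auto
    show "(\<lambda>m. \<integral>\<^sup>+ \<omega>. ennreal ((cmod (b * X \<omega> - b * W m \<omega>))\<^sup>2) \<partial>P) \<longlonglongrightarrow> 0"
      using 1 meas by (intro limit) auto
    show "(\<lambda>z. b * f z) \<in> borel_measurable borel" "(\<lambda>\<omega>. b * X \<omega>) \<in> borel_measurable P"
      using 1(1,2) by (simp_all only: borel_measurable_times borel_measurable_const)
  qed
qed

lemma wiener_integral_zero: "wiener_integral P \<xi> (\<lambda>z. 0) (\<lambda>\<omega>. 0)"
proof -
  have "elementary_integral \<xi> (\<lambda>z. 0) (\<lambda>\<omega>. 0)"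
    unfolding elementary_integral_def by (rule exI[of _ 0]) auto
  then show ?thesis
    unfolding wiener_integral_def
    by (auto intro!: exI[of _ "\<lambda>m z. 0"] exI[of _ "\<lambda>m \<omega>. 0"])
qed

lemma wiener_integral_sum:
  assumes "white_noise P \<xi>" "finite S" "\<And>x. x \<in> S \<Longrightarrow> wiener_integral P \<xi> (f x) (X x)"
  shows "wiener_integral P \<xi> (\<lambda>z. \<Sum>x\<in>S. b x * f x z) (\<lambda>\<omega>. \<Sum>x\<in>S. b x * X x \<omega>)"
  using assms(2,3)
  by (induction S rule: finite_induct)
     (auto intro!: wiener_integral_zero wiener_integral_add wiener_integral_cmult assms(1))

section \<open>Ito isometry and normality for step functions\<close>

text \<open>Both squares expand to the same quadratic form in the numbers
  \<open>measure lborel (A i \<inter> A j)\<close>: on the left by the covariance of the noise, on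
  the right because a product of indicators is the indicator of the intersection.\<close>

lemma white_noise_second_moment:
  fixes r :: "nat \<Rightarrow> real"
  assumes wn: "white_noise P \<xi>" and A: "\<And>i. i < k \<Longrightarrow> A i \<in> bounded_borel"
  shows "(\<integral>\<^sup>+ \<omega>. ennreal ((\<Sum>i<k. r i * \<xi> (A i) \<omega>)\<^sup>2) \<partial>P)
    = (\<integral>\<^sup>+ z. ennreal ((\<Sum>i<k. r i * indicator (A i) z)\<^sup>2) \<partial>lborel)"
proof -
  have X [measurable]: "\<xi> (A i) \<in> borel_measurable P" "integrable P (\<lambda>\<omega>. (\<xi> (A i) \<omega>)\<^sup>2)" if "i < k" for i
    using A[OF that] wn by (auto simp: white_noise_def)
  have cov: "(LINT \<omega>|P. \<xi> (A i) \<omega> * \<xi> (A j) \<omega>) = measure lborel (A i \<inter> A j)" if "i < k" "j < k" for i j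
    using wn A that unfolding white_noise_def by blast
  \<comment> \<open>Only squares are known to be integrable; the mixed products are dominated by
    sums of two squares.\<close>
  have XX: "integrable P (\<lambda>\<omega>. \<xi> (A i) \<omega> * \<xi> (A j) \<omega>)" if "i < k" "j < k" for i j
  proof (rule Bochner_Integration.integrable_bound)
    show "integrable P (\<lambda>\<omega>. (\<xi> (A i) \<omega>)\<^sup>2 + (\<xi> (A j) \<omega>)\<^sup>2)" using X that by auto
    show "(\<lambda>\<omega>. \<xi> (A i) \<omega> * \<xi> (A j) \<omega>) \<in> borel_measurable P" using X that by auto
    have "norm (x * y) \<le> norm (x\<^sup>2 + y\<^sup>2)" for x y :: real
      using sum_squares_bound[of x y] sum_squares_bound[of x "- y"] by (simp add: abs_if)
    then show "AE \<omega> in P. norm (\<xi> (A i) \<omega> * \<xi> (A j) \<omega>) \<le> norm ((\<xi> (A i) \<omega>)\<^sup>2 + (\<xi> (A j) \<omega>)\<^sup>2)" by simp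
  qed
  have II: "integrable lborel (\<lambda>z. indicator (A i) z * indicator (A j) z :: real)"
    "(LINT z|lborel. indicator (A i) z * indicator (A j) z :: real) = measure lborel (A i \<inter> A j)"
    if "i < k" "j < k" for i j
  proof -
    have "A i \<inter> A j \<in> sets lborel" "bounded (A i \<inter> A j)"
      using A[OF that(1)] A[OF that(2)] by (auto simp: bounded_borel_def intro: bounded_subset)
    then show "integrable lborel (\<lambda>z. indicator (A i) z * indicator (A j) z :: real)"
      "(LINT z|lborel. indicator (A i) z * indicator (A j) z :: real) = measure lborel (A i \<inter> A j)"
      using emeasure_bounded_finite[of "A i \<inter> A j"]
      by (auto simp: indicator_inter_arith[symmetric])
  qed
  have sq: "(\<Sum>i<k. r i * x i)\<^sup>2 = (\<Sum>i<k. \<Sum>j<k. r i * r j * (x i * x j))" for x :: "nat \<Rightarrow> real"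
    by (simp add: power2_eq_square sum_product mult_ac)
  let ?v = "\<Sum>i<k. \<Sum>j<k. r i * r j * measure lborel (A i \<inter> A j)"
  have 1: "has_bochner_integral P (\<lambda>\<omega>. (\<Sum>i<k. r i * \<xi> (A i) \<omega>)\<^sup>2) ?v"
    unfolding sq using XX cov
    by (intro has_bochner_integral_sum has_bochner_integral_mult_right) (auto simp: has_bochner_integral_iff)
  have 2: "has_bochner_integral lborel (\<lambda>z. (\<Sum>i<k. r i * indicator (A i) z)\<^sup>2) ?v"
    unfolding sq using II
    by (intro has_bochner_integral_sum has_bochner_integral_mult_right) (auto simp: has_bochner_integral_iff)
  show ?thesis
    by (simp only: nn_integral_eq_integral[OF integrable.intros[OF 1]]
        nn_integral_eq_integral[OF integrable.intros[OF 2]] zero_le_power2 AE_I2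
        1[THEN has_bochner_integral_integral_eq] 2[THEN has_bochner_integral_integral_eq])
qed

lemma nn_integral_power2_cmod:
  assumes [measurable]: "f \<in> borel_measurable M"
  shows "(\<integral>\<^sup>+ x. ennreal ((cmod (f x))\<^sup>2) \<partial>M) =
    (\<integral>\<^sup>+ x. ennreal ((Re (f x))\<^sup>2) \<partial>M) + (\<integral>\<^sup>+ x. ennreal ((Im (f x))\<^sup>2) \<partial>M)"
  by (simp add: cmod_power2 nn_integral_add)

text \<open>The noise is real, so the real and imaginary parts of the integral have coefficients
  \<open>Re (a i)\<close> and \<open>Im (a i)\<close>, and the real isometry applies to
  each.\<close>

lemma elementary_isometry:
  assumes wn: "white_noise P \<xi>" and el: "elementary_integral \<xi> g W"
  shows "(\<integral>\<^sup>+ \<omega>. ennreal ((cmod (W \<omega>))\<^sup>2) \<partial>P) = (\<integral>\<^sup>+ z. ennreal ((cmod (g z))\<^sup>2) \<partial>lborel)"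
proof -
  from el obtain k a A where A: "\<And>i. i < k \<Longrightarrow> A i \<in> bounded_borel"
    and g: "g = (\<lambda>z. \<Sum>i<(k::nat). a i * indicator (A i) z)"
    and W: "W = (\<lambda>\<omega>. \<Sum>i<k. a i * complex_of_real (\<xi> (A i) \<omega>))"
    unfolding elementary_integral_def by blast
  have ind: "indicator B z = complex_of_real (indicator B z)" for B and z :: "real \<times> real"
    by (simp add: indicator_def)
  show ?thesis
    using elementary_integral_measurable[OF assms] white_noise_second_moment[OF wn A, where r="\<lambda>i. Re (a i)"]
      white_noise_second_moment[OF wn A, where r="\<lambda>i. Im (a i)"]
    by (simp add: nn_integral_power2_cmod) (simp add: g W ind)
qed

text \<open>Gaussianity is postulated for real linear combinations, and the real part of a complex
  one is the combination with coefficients \<open>Re (a i)\<close>.\<close>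

lemma Re_elementary_normal:
  assumes wn: "white_noise P \<xi>" and el: "elementary_integral \<xi> g W"
  shows "centred_normal P (\<lambda>\<omega>. Re (W \<omega>))"
proof -
  from el obtain k :: nat and a A where A: "\<And>i. i < k \<Longrightarrow> A i \<in> bounded_borel"
    and W: "W = (\<lambda>\<omega>. \<Sum>i<k. a i * complex_of_real (\<xi> (A i) \<omega>))"
    unfolding elementary_integral_def by blast
  have "centred_gaussian_vector P k (\<lambda>i. \<xi> (A i))"
    using wn A unfolding white_noise_def by blast
  from this[unfolded centred_gaussian_vector_def, rule_format, of "\<lambda>i. Re (a i)"]
  show ?thesis by (simp add: W)
qed

section \<open>Small-ball estimates\<close>

text \<open>A normal density with standard deviation \<open>s\<close> is at most
  \<open>1 / (2 * s)\<close>, so an interval of length \<open>2 * \<delta>\<close> has mass at most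
  \<open>\<delta> / s\<close>.\<close>

lemma (in prob_space) centred_normal_small_ball:
  assumes X: "centred_normal M X" and \<sigma>: "\<sigma> > 0" and \<delta>: "\<delta> \<ge> 0"
    and var: "ennreal (\<sigma>\<^sup>2) \<le> (\<integral>\<^sup>+ \<omega>. ennreal ((X \<omega>)\<^sup>2) \<partial>M)"
  shows "prob {\<omega> \<in> space M. \<bar>X \<omega>\<bar> \<le> \<delta>} \<le> \<delta> / \<sigma>"
proof -
  from X have [measurable]: "X \<in> borel_measurable M" by (simp add: centred_normal_def)
  \<comment> \<open>The definition of a centred normal variable admits the degenerate one; the
    positive second moment excludes it.\<close>
  have "\<not> (AE \<omega> in M. X \<omega> = 0)"
  proof
    assume "AE \<omega> in M. X \<omega> = 0"
    then have "(\<integral>\<^sup>+ \<omega>. ennreal ((X \<omega>)\<^sup>2) \<partial>M) = 0"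
      by (subst nn_integral_0_iff_AE) auto
    with var \<sigma> show False by simp
  qed
  then obtain s where s: "s > 0" and D: "distributed M lborel X (normal_density 0 s)"
    using X by (auto simp: centred_normal_def)
  have "(\<integral>\<^sup>+ \<omega>. ennreal ((X \<omega>)\<^sup>2) \<partial>M) = (\<integral>\<^sup>+ x. ennreal (normal_density 0 s x * x\<^sup>2) \<partial>lborel)"
    using distributed_nn_integral[OF D, of "\<lambda>x. ennreal (x\<^sup>2)"] by (simp add: ennreal_mult)
  also have "\<dots> = ennreal (s\<^sup>2)"
    using normal_moment_even[OF s, of 0 1] s
    by (subst nn_integral_eq_integral) (auto simp: has_bochner_integral_iff fact_numeral)
  finally have "\<sigma>\<^sup>2 \<le> s\<^sup>2" using var by simp
  then have le: "\<sigma> \<le> s" using \<sigma> s by (simp add: power2_le_iff_abs_le)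
  have "emeasure M {\<omega> \<in> space M. \<bar>X \<omega>\<bar> \<le> \<delta>} = emeasure M (X -` {-\<delta>..\<delta>} \<inter> space M)"
    by (intro arg_cong[where f="emeasure M"]) auto
  also have "\<dots> = (\<integral>\<^sup>+ x. ennreal (normal_density 0 s x) * indicator {-\<delta>..\<delta>} x \<partial>lborel)"
    by (intro distributed_emeasure[OF D]) auto
  also have "\<dots> \<le> (\<integral>\<^sup>+ x. ennreal (1 / (2 * s)) * indicator {-\<delta>..\<delta>} x \<partial>lborel)"
  proof (intro nn_integral_mono mult_right_mono ennreal_leI)
    fix x
    have "2 \<le> sqrt (2 * pi)" using pi_gt3 by (intro real_le_rsqrt) auto
    then have "2 * s \<le> sqrt (2 * pi * s\<^sup>2)" using s by (simp add: real_sqrt_mult)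
    then have "1 / sqrt (2 * pi * s\<^sup>2) * exp (- (x - 0)\<^sup>2 / (2 * s\<^sup>2)) \<le> 1 / (2 * s) * 1"
      using s by (intro mult_mono divide_left_mono) auto
    then show "normal_density 0 s x \<le> 1 / (2 * s)" by (simp add: normal_density_def)
  qed auto
  also have "\<dots> = ennreal (\<delta> / s)"
    using \<delta> s by (simp add: nn_integral_cmult ennreal_mult[symmetric])
  finally have "prob {\<omega> \<in> space M. \<bar>X \<omega>\<bar> \<le> \<delta>} \<le> \<delta> / s"
    using \<delta> s by (simp add: emeasure_eq_measure)
  also have "\<dots> \<le> \<delta> / \<sigma>" using \<delta> \<sigma> le by (intro divide_left_mono) auto
  finally show ?thesis .
qed

lemma (in prob_space) nn_Chebyshev:
  assumes [measurable]: "Y \<in> borel_measurable M" and \<delta>: "\<delta> > 0"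
    and le: "(\<integral>\<^sup>+ \<omega>. ennreal ((cmod (Y \<omega>))\<^sup>2) \<partial>M) \<le> ennreal e"
    and e: "e \<ge> 0"
  shows "prob {\<omega> \<in> space M. cmod (Y \<omega>) \<ge> \<delta>} \<le> e / \<delta>\<^sup>2"
proof -
  have fin: "integrable M (\<lambda>\<omega>. (cmod (Y \<omega>))\<^sup>2)"
    using le by (intro integrableI_nonneg) (auto intro: le_less_trans)
  have "prob {\<omega> \<in> space M. \<bar>cmod (Y \<omega>)\<bar> \<ge> \<delta>} \<le> expectation (\<lambda>\<omega>. (cmod (Y \<omega>))\<^sup>2) / \<delta>\<^sup>2"
    using fin \<delta> by (intro second_moment_method) auto
  also have "\<dots> \<le> e / \<delta>\<^sup>2"
    using le e by (intro divide_right_mono) (auto simp: nn_integral_eq_integral[OF fin])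
  finally show ?thesis by simp
qed

text \<open>The approximating step integrals are complex, but \<open>X\<close> is real, so their imaginary parts vanish in
  the limit and \<open>X\<close> inherits the whole variance through the real parts.  Only approximants have to be
  normal.\<close>

lemma (in prob_space) wiener_integral_small_ball:
  assumes wn: "white_noise M \<xi>"
    and X: "wiener_integral M \<xi> f (\<lambda>\<omega>. complex_of_real (X \<omega>))"
    and \<sigma>: "\<sigma> > 0" and \<delta>: "\<delta> > 0"
    and var: "ennreal (\<sigma>\<^sup>2) \<le> (\<integral>\<^sup>+ z. ennreal ((cmod (f z))\<^sup>2) \<partial>lborel)"
  shows "prob {\<omega> \<in> space M. \<bar>X \<omega>\<bar> \<le> \<delta>} \<le> 4 * \<delta> / \<sigma>"
proof (rule field_le_epsilon)
  \<comment> \<open>The slack \<eta> absorbs the probability that the approximant is off by at least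
    \<delta>.\<close>
  fix \<eta> :: real assume \<eta>: "\<eta> > 0"
  from X obtain g W where 1: "f \<in> borel_measurable borel" "(\<lambda>\<omega>. complex_of_real (X \<omega>)) \<in> borel_measurable M"
      "\<And>m. elementary_integral \<xi> (g m) (W m)"
      "(\<lambda>m. \<integral>\<^sup>+ z. ennreal ((cmod (f z - g m z))\<^sup>2) \<partial>lborel) \<longlonglongrightarrow> 0"
      "(\<lambda>m. \<integral>\<^sup>+ \<omega>. ennreal ((cmod (complex_of_real (X \<omega>) - W m \<omega>))\<^sup>2) \<partial>M) \<longlonglongrightarrow> 0"
    unfolding wiener_integral_def by blast
  have [measurable]: "X \<in> borel_measurable M"
    using measurable_compose[OF 1(2) borel_measurable_Re] by simp
  \<comment> \<open>The second bound turns Chebyshev's \<open>e / \<delta>\<^sup>2\<close> into at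
    most \<eta>. The first one serves the estimate
    \<open>\<sigma>\<^sup>2 \<le> 2 * r + 4 * e\<close> below, where \<open>r\<close> is the second
    moment of the real part: it leaves a quarter of the variance.\<close>
  define e where "e = min (\<sigma>\<^sup>2 / 8) (\<eta> * \<delta>\<^sup>2)"
  have e: "e > 0" "e \<le> \<sigma>\<^sup>2 / 8" "e \<le> \<eta> * \<delta>\<^sup>2" using \<sigma> \<eta> \<delta> by (auto simp: e_def)
  have "\<forall>\<^sub>F m in sequentially. (\<integral>\<^sup>+ z. ennreal ((cmod (f z - g m z))\<^sup>2) \<partial>lborel) < ennreal e"
    "\<forall>\<^sub>F m in sequentially. (\<integral>\<^sup>+ \<omega>. ennreal ((cmod (complex_of_real (X \<omega>) - W m \<omega>))\<^sup>2) \<partial>M) < ennreal e"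
    using e(1) by (auto intro!: order_tendstoD(2)[OF 1(4)] order_tendstoD(2)[OF 1(5)])
  from eventually_happens[OF eventually_conj[OF this]] obtain m where
    m: "(\<integral>\<^sup>+ z. ennreal ((cmod (f z - g m z))\<^sup>2) \<partial>lborel) < ennreal e"
       "(\<integral>\<^sup>+ \<omega>. ennreal ((cmod (complex_of_real (X \<omega>) - W m \<omega>))\<^sup>2) \<partial>M) < ennreal e"
    by auto
  note [measurable] = elementary_integral_measurable[OF wn 1(3)[of m]] 1(1)
  let ?I = "\<lambda>Y. \<integral>\<^sup>+ \<omega>. ennreal ((Y \<omega>)\<^sup>2) \<partial>M"
  have Im: "?I (\<lambda>\<omega>. Im (W m \<omega>)) \<le> ennreal e"
  proof -
    have "?I (\<lambda>\<omega>. Im (W m \<omega>)) \<le> ?I (\<lambda>\<omega>. cmod (complex_of_real (X \<omega>) - W m \<omega>))"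
    proof (intro nn_integral_mono ennreal_leI)
      fix \<omega>
      show "(Im (W m \<omega>))\<^sup>2 \<le> (cmod (complex_of_real (X \<omega>) - W m \<omega>))\<^sup>2"
        by (simp add: cmod_power2)
    qed
    with m(2) show ?thesis by simp
  qed
  have "ennreal (\<sigma>\<^sup>2) \<le> (\<integral>\<^sup>+ z. ennreal ((cmod (g m z + (f z - g m z)))\<^sup>2) \<partial>lborel)"
    using var by simp
  also have "\<dots> \<le> 2 * (\<integral>\<^sup>+ z. ennreal ((cmod (g m z))\<^sup>2) \<partial>lborel)
      + 2 * (\<integral>\<^sup>+ z. ennreal ((cmod (f z - g m z))\<^sup>2) \<partial>lborel)"
    by (intro nn_integral_power2_norm_add_le) auto
  also have "\<dots> \<le> 2 * (\<integral>\<^sup>+ z. ennreal ((cmod (g m z))\<^sup>2) \<partial>lborel) + 2 * ennreal e"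
    using m(1) by (intro add_left_mono mult_left_mono) auto
  also have "(\<integral>\<^sup>+ z. ennreal ((cmod (g m z))\<^sup>2) \<partial>lborel) = ?I (\<lambda>\<omega>. Re (W m \<omega>)) + ?I (\<lambda>\<omega>. Im (W m \<omega>))"
    unfolding elementary_isometry[OF wn 1(3), symmetric] by (intro nn_integral_power2_cmod) auto
  also have "2 * (?I (\<lambda>\<omega>. Re (W m \<omega>)) + ?I (\<lambda>\<omega>. Im (W m \<omega>))) + 2 * ennreal e
      \<le> 2 * (?I (\<lambda>\<omega>. Re (W m \<omega>)) + ennreal e) + 2 * ennreal e"
    using Im by (intro add_right_mono mult_left_mono add_left_mono) auto
  finally have *: "ennreal (\<sigma>\<^sup>2) \<le> 2 * (?I (\<lambda>\<omega>. Re (W m \<omega>)) + ennreal e) + 2 * ennreal e" .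
  have "ennreal ((\<sigma> / 2)\<^sup>2) \<le> ?I (\<lambda>\<omega>. Re (W m \<omega>))"
  proof (cases "?I (\<lambda>\<omega>. Re (W m \<omega>))")
    case (real r)
    have "2 * (ennreal r + ennreal e) + 2 * ennreal e = ennreal (2 * (r + e) + 2 * e)"
      using real e by (simp only: ennreal_plus[symmetric] ennreal_mult'[symmetric] ennreal_numeral[symmetric] zero_le_numeral mult_nonneg_nonneg less_imp_le add_nonneg_nonneg)
    with * have "ennreal (\<sigma>\<^sup>2) \<le> ennreal (2 * (r + e) + 2 * e)" by (simp add: real)
    then have "\<sigma>\<^sup>2 \<le> 2 * (r + e) + 2 * e" using real e by (simp del: ennreal_plus)
    then have "(\<sigma> / 2)\<^sup>2 \<le> r" using e by (simp add: power2_eq_square)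
    then show ?thesis using real by (simp add: ennreal_leI)
  qed auto
  \<comment> \<open>The factor 4 is composed of two losses: the radius is doubled to leave room for
    an error of size \<delta>, and the standard deviation is halved.\<close>
  then have small: "prob {\<omega> \<in> space M. \<bar>Re (W m \<omega>)\<bar> \<le> 2 * \<delta>} \<le> 2 * \<delta> / (\<sigma> / 2)"
    using \<sigma> \<delta> by (intro centred_normal_small_ball Re_elementary_normal[OF wn 1(3)]) auto
  have "prob {\<omega> \<in> space M. \<bar>X \<omega>\<bar> \<le> \<delta>} \<le>
      prob ({\<omega> \<in> space M. \<bar>Re (W m \<omega>)\<bar> \<le> 2 * \<delta>} \<union> {\<omega> \<in> space M. cmod (complex_of_real (X \<omega>) - W m \<omega>) \<ge> \<delta>})"
  proof (intro finite_measure_mono subsetI)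
    fix \<omega> assume \<omega>: "\<omega> \<in> {\<omega> \<in> space M. \<bar>X \<omega>\<bar> \<le> \<delta>}"
    have "\<bar>X \<omega> - Re (W m \<omega>)\<bar> \<le> cmod (complex_of_real (X \<omega>) - W m \<omega>)"
      using abs_Re_le_cmod[of "complex_of_real (X \<omega>) - W m \<omega>"] by simp
    with \<omega> show "\<omega> \<in> {\<omega> \<in> space M. \<bar>Re (W m \<omega>)\<bar> \<le> 2 * \<delta>} \<union> {\<omega> \<in> space M. cmod (complex_of_real (X \<omega>) - W m \<omega>) \<ge> \<delta>}"
      by auto
  qed measurable
  also have "\<dots> \<le> prob {\<omega> \<in> space M. \<bar>Re (W m \<omega>)\<bar> \<le> 2 * \<delta>}
      + prob {\<omega> \<in> space M. cmod (complex_of_real (X \<omega>) - W m \<omega>) \<ge> \<delta>}"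
    by (intro measure_Un_le) measurable
  also have "prob {\<omega> \<in> space M. cmod (complex_of_real (X \<omega>) - W m \<omega>) \<ge> \<delta>} \<le> e / \<delta>\<^sup>2"
    using m(2) e \<delta> by (intro nn_Chebyshev) auto
  also have "e / \<delta>\<^sup>2 \<le> \<eta>" using e \<delta> by (simp add: divide_le_eq)
  finally show "prob {\<omega> \<in> space M. \<bar>X \<omega>\<bar> \<le> \<delta>} \<le> 4 * \<delta> / \<sigma> + \<eta>"
    using small by simp
qed

section \<open>Fourier coefficients of the kernels\<close>

lemma fourier_mult: "fourier j x * fourier k x = fourier (j + k) x"
  by (simp add: fourier_def algebra_simps flip: exp_add)

lemma fourier_diff: "fourier j (x - y) = fourier j x * fourier (- j) y"
  by (simp add: fourier_def algebra_simps flip: exp_add)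

lemma fourier_eq_cis: "fourier j x = cis (2 * pi * of_int j * x)"
  by (simp add: fourier_def cis_conv_exp mult_ac)

lemma norm_fourier [simp]: "cmod (fourier j x) = 1"
  by (simp add: fourier_eq_cis)

lemma fourier_0 [simp]: "fourier 0 x = 1" "fourier j 0 = 1"
  by (simp_all add: fourier_def)

lemma fourier_measurable [measurable]: "fourier j \<in> borel_measurable borel"
  unfolding fourier_def by (intro borel_measurable_continuous_onI continuous_intros)

lemma fourier_one [simp]: "fourier j 1 = 1"
  using exp_integer_2pi[of "of_int j"] by (simp add: fourier_def mult_ac)

lemma fourier_add_right: "fourier j (x + y) = fourier j x * fourier j y"
  by (simp add: fourier_def algebra_simps flip: exp_add)

lemma fourier_of_nat_div: "fourier j (real k / N) = fourier j (1 / N) ^ k"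
  by (simp add: fourier_def mult_ac flip: exp_of_nat_mult)

lemma fourier_eq_1_iff: "fourier j x = 1 \<longleftrightarrow> (\<exists>k::int. of_int j * x = of_int k)"
proof -
  have "fourier j x = 1 \<longleftrightarrow> (\<exists>k::int. 2 * pi * of_int j * x = of_int (2 * k) * pi)"
    by (simp add: fourier_def exp_eq_1 mult_ac)
  also have "\<dots> \<longleftrightarrow> (\<exists>k::int. of_int j * x = of_int k)"
    by (simp add: field_simps)
  finally show ?thesis .
qed

lemma fourier_inverse_nat_eq_1_iff:
  assumes "N > 0"
  shows "fourier j (1 / real N) = 1 \<longleftrightarrow> int N dvd j"
proof -
  have "fourier j (1 / real N) = 1 \<longleftrightarrow> (\<exists>k::int. real_of_int j = of_int (int N * k))"
    using assms by (simp add: fourier_eq_1_iff field_simps)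
  also have "\<dots> \<longleftrightarrow> int N dvd j" unfolding of_int_eq_iff dvd_def ..
  finally show ?thesis .
qed

text \<open>A geometric sum over powers of an \<open>N\<close>-th root of unity, which vanishes
  unless that root is 1. All aliasing below comes from this.\<close>

lemma fourier_sum_roots:
  assumes "N > 0"
  shows "(\<Sum>k<N. fourier j (real k / N)) = (if int N dvd j then of_nat N else 0)"
proof -
  have "fourier j (1 / real N) ^ N = 1"
    using fourier_of_nat_div[of j N "real N"] assms by simp
  then show ?thesis
    using fourier_inverse_nat_eq_1_iff[OF assms, of j]
    unfolding fourier_of_nat_div by (auto simp: geometric_sum)
qed

lemma fourier_interval_integral:
  assumes "j \<noteq> 0" "a \<le> b"
  shows "has_bochner_integral lborel (\<lambda>y. indicator {a..<b} y *\<^sub>R fourier j y)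
    ((fourier j b - fourier j a) / (2 * pi * \<i> * of_int j))"
proof -
  let ?F = "\<lambda>y. fourier j y / (2 * pi * \<i> * of_int j)"
  have "has_bochner_integral lborel (\<lambda>y. indicator {a..b} y *\<^sub>R fourier j y) (?F b - ?F a)"
  proof (rule has_bochner_integral_FTC_Icc[OF assms(2)])
    fix x
    have "((\<lambda>z. exp (2 * of_real pi * \<i> * of_int j * z) / (2 * pi * \<i> * of_int j))
        has_field_derivative exp (2 * of_real pi * \<i> * of_int j * of_real x)) (at (of_real x))"
      using assms by (auto intro!: derivative_eq_intros)
    from has_vector_derivative_real_field[OF this]
    show "(?F has_vector_derivative fourier j x) (at x within {a..b})"
      unfolding fourier_def by (rule has_vector_derivative_at_within)
  qed (auto simp: fourier_def intro!: continuous_intros)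
  \<comment> \<open>The fundamental theorem yields the closed interval, whereas the grid cells are
    half-open; they differ by the null set \<open>{b}\<close>.\<close>
  moreover have "AE y in lborel. indicator {a..<b} y *\<^sub>R fourier j y = indicator {a..b} y *\<^sub>R fourier j y"
    using AE_lborel_singleton[of b] by eventually_elim (auto simp: indicator_def)
  ultimately show ?thesis
    by (subst has_bochner_integral_cong_AE[where g="\<lambda>y. indicator {a..b} y *\<^sub>R fourier j y"])
       (auto simp: diff_divide_distrib)
qed

lemma fourier_unit_integral:
  "has_bochner_integral lborel (\<lambda>y. indicator {0..<1} y *\<^sub>R fourier j y) (if j = 0 then 1 else 0)"
proof (cases "j = 0")
  case True
  have "has_bochner_integral lborel (\<lambda>y. indicator {0..<1::real} y *\<^sub>R (1::complex))
      (measure lborel {0..<1::real} *\<^sub>R 1)"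
    by (intro has_bochner_integral_scaleR_left has_bochner_integral_real_indicator) auto
  with True show ?thesis by simp
next
  case False
  then show ?thesis using fourier_interval_integral[of j 0 1] by simp
qed

section \<open>Fourier coefficients of the heat kernel\<close>

lemma summable_on_int_nonneg:
  fixes a :: "int \<Rightarrow> real"
  assumes nn: "\<And>j. a j \<ge> 0" and "summable (\<lambda>k. a (int k))" "summable (\<lambda>k. a (- int k))"
  shows "a summable_on UNIV"
proof -
  have "(\<lambda>k. a (int k)) summable_on UNIV" "(\<lambda>k. a (- int k)) summable_on UNIV"
    using assms by (auto intro!: norm_summable_imp_summable_on)
  then have "a summable_on range int" "a summable_on range (\<lambda>k. - int k)"
    by (subst summable_on_reindex, auto simp: o_def inj_on_def)+
  then have "a summable_on (range int \<union> range (\<lambda>k. - int k))"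
    using nn by (rule_tac summable_on_union) auto
  also have "range int \<union> range (\<lambda>k. - int k) = UNIV"
    by (auto simp: image_iff) (metis int_cases2)
  finally show ?thesis .
qed

lemma heat_coeff_summable:
  assumes "\<tau> > 0"
  shows "(\<lambda>j::int. exp (- 4 * pi\<^sup>2 * (of_int j)\<^sup>2 * \<tau>)) summable_on UNIV"
proof -
  let ?r = "exp (- 4 * pi\<^sup>2 * \<tau>)"
  have "exp (- 4 * pi\<^sup>2 * (real k)\<^sup>2 * \<tau>) \<le> ?r ^ k" for k
  proof -
    have "real k \<le> (real k)\<^sup>2" using of_nat_le_iff[of k "k\<^sup>2"] by (simp add: power2_eq_square)
    then have "(4 * pi\<^sup>2 * \<tau>) * real k \<le> (4 * pi\<^sup>2 * \<tau>) * (real k)\<^sup>2"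
      using assms by (intro mult_left_mono) auto
    then show ?thesis by (simp add: exp_of_nat_mult[symmetric] algebra_simps)
  qed
  moreover have "summable (\<lambda>k. ?r ^ k)" using assms by (intro summable_geometric) auto
  ultimately have "summable (\<lambda>k. exp (- 4 * pi\<^sup>2 * (real k)\<^sup>2 * \<tau>))"
    by (rule_tac summable_comparison_test'[where g="\<lambda>k. ?r ^ k" and N=0]) auto
  then show ?thesis by (intro summable_on_int_nonneg) auto
qed

text \<open>An unordered sum is a limit along all finite index sets. This extracts a sequence of
  partial sums, to which dominated convergence applies.\<close>

lemma symmetric_intervals_exhaust:
  "filterlim (\<lambda>M. {- int M..int M}) (finite_subsets_at_top UNIV) sequentially"
  unfolding filterlim_finite_subsets_at_top
proof (intro allI impI, elim conjE)
  fix X :: "int set" assume X: "finite X"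
  show "\<forall>\<^sub>F M in sequentially. finite {- int M..int M} \<and> X \<subseteq> {- int M..int M} \<and> {- int M..int M} \<subseteq> UNIV"
    using eventually_ge_at_top[of "nat (\<Sum>j\<in>X. \<bar>j\<bar>)"]
  proof eventually_elim
    case (elim M)
    have "\<bar>j\<bar> \<le> int M" if "j \<in> X" for j
      using member_le_sum[of j X abs] X that elim by auto
    then show ?case by force
  qed
qed

text \<open>As \<open>fourier j (x - y)\<close> contains \<open>fourier (- j) y\<close>, integrating
  against \<open>fourier m\<close> selects the index \<open>j = m\<close>. Sum and integral are
  exchanged by dominated convergence: the partial sums are bounded by the total of the coefficients,
  a constant on an interval of length 1.\<close>

lemma heat_kernel_fourier_coeff:
  assumes \<tau>: "\<tau> > 0"
  shows "has_bochner_integral lborel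
    (\<lambda>y. indicator {0..<1} y *\<^sub>R (heat_kernel \<tau> x y * fourier m y))
    (of_real (exp (- 4 * pi\<^sup>2 * (of_int m)\<^sup>2 * \<tau>)) * fourier m x)"
proof -
  define a where "a j = exp (- 4 * pi\<^sup>2 * (of_int j)\<^sup>2 * \<tau>)" for j :: int
  have sum_a: "a summable_on UNIV" and a_nonneg: "a j \<ge> 0" for j
    unfolding a_def using heat_coeff_summable[OF \<tau>] by auto
  define S where "S M y = (\<Sum>j\<in>{- int M..int M}. of_real (a j) * fourier j (x - y))" for M y
  let ?B = "infsum a UNIV"
  have S_meas [measurable]: "S M \<in> borel_measurable borel" for M
    unfolding S_def by measurable
  have S_lim: "(\<lambda>M. S M y) \<longlonglongrightarrow> heat_kernel \<tau> x y" for y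
  proof -
    have "(\<lambda>j. norm (of_real (a j) * fourier j (x - y))) summable_on UNIV"
      using sum_a by (simp add: norm_mult a_nonneg)
    then have "((\<lambda>j. of_real (a j) * fourier j (x - y)) has_sum heat_kernel \<tau> x y) UNIV"
      unfolding heat_kernel_def a_def[symmetric]
      by (rule has_sum_infsum[OF Infinite_Sum.abs_summable_summable])
    then show ?thesis
      unfolding S_def has_sum_def by (rule filterlim_compose) (rule symmetric_intervals_exhaust)
  qed
  then have heat_meas [measurable]: "heat_kernel \<tau> x \<in> borel_measurable borel"
    by (intro borel_measurable_LIMSEQ_metric[OF S_meas])
  have S_bound: "cmod (S M y) \<le> ?B" for M y
  proof -
    have "cmod (S M y) \<le> (\<Sum>j\<in>{- int M..int M}. a j)"
      unfolding S_def by (rule sum_norm_le) (simp add: norm_mult a_def)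
    also have "\<dots> \<le> ?B"
      by (intro finite_sum_le_infsum sum_a) (auto simp: a_def)
    finally show ?thesis .
  qed
  have shift: "fourier (m - j) y = fourier m y * fourier (- j) y" for j y
    by (simp add: fourier_mult)
  \<comment> \<open>Once \<open>M\<close> reaches \<open>\<bar>m\<bar>\<close>, the partial sum
    contains the index \<open>m\<close> and its coefficient no longer changes, so the limit is that
    of an eventually constant sequence.\<close>
  have S_int: "(LINT y|lborel. indicator {0..<1} y *\<^sub>R (S M y * fourier m y)) = of_real (a m) * fourier m x"
    if "nat \<bar>m\<bar> \<le> M" for M
  proof -
    have "has_bochner_integral lborel
       (\<lambda>y. \<Sum>j\<in>{- int M..int M}. of_real (a j) * fourier j x * (indicator {0..<1} y *\<^sub>R fourier (m - j) y))
       (\<Sum>j\<in>{- int M..int M}. of_real (a j) * fourier j x * (if m - j = 0 then 1 else 0))"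
      by (intro has_bochner_integral_sum has_bochner_integral_mult_right fourier_unit_integral)
    also have "(\<lambda>y. \<Sum>j\<in>{- int M..int M}. of_real (a j) * fourier j x * (indicator {0..<1} y *\<^sub>R fourier (m - j) y))
       = (\<lambda>y. indicator {0..<1} y *\<^sub>R (S M y * fourier m y))"
      by (simp add: S_def fun_eq_iff sum_distrib_right sum_distrib_left fourier_diff scaleR_conv_of_real
          shift mult_ac)
    also have "(\<Sum>j\<in>{- int M..int M}. of_real (a j) * fourier j x * (if m - j = 0 then 1 else 0))
       = (\<Sum>j\<in>{- int M..int M}. if m = j then of_real (a j) * fourier j x else 0)"
      by (intro sum.cong) auto
    also have "\<dots> = of_real (a m) * fourier m x"
      using that by (auto simp: abs_le_iff)
    finally show ?thesis by (rule has_bochner_integral_integral_eq)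
  qed
  have dom: "integrable lborel (\<lambda>y. indicator {0..<1::real} y *\<^sub>R ?B)" by simp
  have meas: "(\<lambda>y. indicator {0..<1} y *\<^sub>R (heat_kernel \<tau> x y * fourier m y)) \<in> borel_measurable lborel"
    "(\<lambda>y. indicator {0..<1} y *\<^sub>R (S M y * fourier m y)) \<in> borel_measurable lborel" for M
    by measurable
  have conv: "AE y in lborel. (\<lambda>M. indicator {0..<1} y *\<^sub>R (S M y * fourier m y)) \<longlonglongrightarrow>
      indicator {0..<1} y *\<^sub>R (heat_kernel \<tau> x y * fourier m y)"
    by (intro AE_I2 tendsto_intros S_lim)
  have bound: "AE y in lborel. norm (indicator {0..<1} y *\<^sub>R (S M y * fourier m y)) \<le> indicator {0..<1} y *\<^sub>R ?B" for M
    by (intro AE_I2) (simp add: norm_mult S_bound indicator_def)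
  note * = integrable_dominated_convergence[OF meas dom conv bound]
    integral_dominated_convergence[OF meas dom conv bound]
  have "(\<lambda>M. LINT y|lborel. indicator {0..<1} y *\<^sub>R (S M y * fourier m y)) \<longlonglongrightarrow> of_real (a m) * fourier m x"
    by (rule tendsto_eventually)
       (use S_int in \<open>auto simp: eventually_sequentially\<close>)
  from LIMSEQ_unique[OF *(2) this] *(1) show ?thesis
    by (simp add: has_bochner_integral_iff a_def)
qed

section \<open>Rounding and aliasing in the discrete kernel\<close>

text \<open>On the cell starting at \<open>k / (2 * n)\<close> the mode \<open>j\<close> is frozen,
  and the integral of \<open>fourier m\<close> is its value at that point times a number independent
  of \<open>k\<close>. Adding up the cells leaves a sum of mode \<open>j + m\<close> over roots of
  unity.\<close>

lemma rho_fourier_coeff: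
  assumes n: "n \<ge> 1" and m: "m \<noteq> 0"
  shows "has_bochner_integral lborel
    (\<lambda>y. indicator {0..<1} y *\<^sub>R (fourier j (rho n y) * fourier m y))
    (if 2 * int n dvd j + m then 2 * of_nat n * (fourier m (1 / (2 * real n)) - 1) / (2 * pi * \<i> * of_int m) else 0)"
proof -
  let ?N = "2 * n"
  have cells: "indicator {0..<1} y *\<^sub>R (fourier j (rho n y) * fourier m y) =
     (\<Sum>k<?N. fourier j (real k / ?N) * (indicator {real k / ?N..<real (Suc k) / ?N} y *\<^sub>R fourier m y))" for y
  proof (cases "y \<in> {0..<1}")
    case True
    define i where "i = nat \<lfloor>2 * real n * y\<rfloor>"
    have i: "real i = of_int \<lfloor>2 * real n * y\<rfloor>" using True by (simp add: i_def)
    have "2 * real n * y < 2 * real n * 1" using True n by (intro mult_strict_left_mono) auto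
    then have iN: "i < ?N" using i by linarith
    have ind: "indicator {real k / ?N..<real (Suc k) / ?N} y = (if k = i then 1 else 0 :: real)" for k
    proof -
      have "y \<in> {real k / ?N..<real (Suc k) / ?N} \<longleftrightarrow> real k \<le> 2 * real n * y \<and> 2 * real n * y < real k + 1"
        using n by (simp add: field_simps)
      also have "\<dots> \<longleftrightarrow> k = i"
        using i by linarith
      finally show ?thesis by (simp add: indicator_def)
    qed
    have "(\<Sum>k<?N. fourier j (real k / ?N) * (indicator {real k / ?N..<real (Suc k) / ?N} y *\<^sub>R fourier m y))
      = (\<Sum>k<?N. if k = i then fourier j (real k / ?N) * fourier m y else 0)"
      unfolding ind by (intro sum.cong) auto
    also have "\<dots> = fourier j (rho n y) * fourier m y"
      using iN by (simp add: rho_def i)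
    finally show ?thesis using True by simp
  next
    case False
    have "y \<notin> {real k / ?N..<real (Suc k) / ?N}" if "k < ?N" for k
    proof
      assume y: "y \<in> {real k / ?N..<real (Suc k) / ?N}"
      have "0 \<le> real k / ?N" "real (Suc k) / ?N \<le> 1" using that n by (auto simp: field_simps)
      with y False show False by auto
    qed
    then show ?thesis using False by simp
  qed
  have "has_bochner_integral lborel
     (\<lambda>y. \<Sum>k<?N. fourier j (real k / ?N) * (indicator {real k / ?N..<real (Suc k) / ?N} y *\<^sub>R fourier m y))
     (\<Sum>k<?N. fourier j (real k / ?N) * ((fourier m (real (Suc k) / ?N) - fourier m (real k / ?N)) / (2 * pi * \<i> * of_int m)))"
    using m by (intro has_bochner_integral_sum has_bochner_integral_mult_right fourier_interval_integral)
      (auto intro!: divide_right_mono)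
  also have "(\<Sum>k<?N. fourier j (real k / ?N) * ((fourier m (real (Suc k) / ?N) - fourier m (real k / ?N)) / (2 * pi * \<i> * of_int m)))
     = (\<Sum>k<?N. fourier (j + m) (real k / ?N)) * ((fourier m (1 / ?N) - 1) / (2 * pi * \<i> * of_int m))"
    unfolding sum_distrib_right
  proof (intro sum.cong refl)
    fix k
    have "real (Suc k) / ?N = real k / ?N + 1 / ?N" by (simp add: add_divide_distrib)
    then have "fourier m (real (Suc k) / ?N) = fourier m (real k / ?N) * fourier m (1 / ?N)"
      by (metis fourier_add_right)
    then show "fourier j (real k / ?N) * ((fourier m (real (Suc k) / ?N) - fourier m (real k / ?N)) / (2 * pi * \<i> * of_int m))
      = fourier (j + m) (real k / ?N) * ((fourier m (1 / ?N) - 1) / (2 * pi * \<i> * of_int m))"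
      by (simp only: fourier_mult[symmetric]) (simp add: algebra_simps diff_divide_distrib)
  qed
  also have "(\<Sum>k<?N. fourier (j + m) (real k / ?N)) = (if 2 * int n dvd j + m then 2 * of_nat n else 0)"
    using fourier_sum_roots[of ?N "j + m"] n by simp
  finally show ?thesis
    unfolding cells by (cases "2 * int n dvd j + m") (simp_all add: mult_ac)
qed

lemma fourier_grid_periodic:
  assumes "x \<in> grid n"
  shows "fourier (j + 2 * int n * k) x = fourier j x"
proof -
  from assms obtain i where i: "x = real i / (2 * real n)" "i < 2 * n" by (auto simp: grid_def)
  have "fourier (2 * int n * k) x = 1"
    unfolding fourier_eq_1_iff using i by (intro exI[of _ "k * int i"]) auto
  then show ?thesis by (simp add: fourier_mult[symmetric])
qed

lemma finite_grid [simp]: "finite (grid n)"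
  by (simp add: grid_def)

lemma sum_grid: "n \<ge> 1 \<Longrightarrow> (\<Sum>x\<in>grid n. f x) = (\<Sum>k<2 * n. f (real k / (2 * real n)))"
  unfolding grid_def by (subst sum.reindex) (auto simp: inj_on_def)

lemma card_grid: "n \<ge> 1 \<Longrightarrow> card (grid n) = 2 * n"
  using sum_grid[of n "\<lambda>x. 1::nat"] by simp

text \<open>The cosine times mode 1 is \<open>(1 + fourier 2 x) / 2\<close>, and mode 2 averages to
  zero over the grid unless \<open>2 * n\<close> divides 2; hence \<open>n \<ge> 2\<close>.\<close>

lemma grid_fourier_cos_sum:
  assumes n: "n \<ge> 2"
  shows "(\<Sum>x\<in>grid n. of_real (cos (2 * pi * x) / (2 * real n)) * fourier 1 x) = 1 / 2"
proof -
  have cos: "of_real (cos (2 * pi * x)) * fourier 1 x = (1 + fourier 2 x) / 2" for x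
  proof -
    have "of_real (cos (2 * pi * x)) = (fourier 1 x + fourier (-1) x) / 2"
      by (simp add: fourier_eq_cis complex_eq_iff)
    then show ?thesis by (simp add: algebra_simps fourier_mult add_divide_distrib)
  qed
  have "(\<Sum>x\<in>grid n. of_real (cos (2 * pi * x) / (2 * real n)) * fourier 1 x)
     = (\<Sum>x\<in>grid n. (1 + fourier 2 x)) / (2 * (2 * of_nat n))"
    unfolding sum_divide_distrib using cos by (intro sum.cong) (simp_all add: divide_simps mult_ac)
  also have "(\<Sum>x\<in>grid n. (1 + fourier 2 x)) = 2 * of_nat n"
    using n fourier_sum_roots[of "2 * n" 2]
    by (simp add: card_grid sum_grid[of n "fourier 2"] sum.distrib zdvd_not_zless)
  finally show ?thesis using n by simp
qed

text \<open>The indices of the discrete kernel represent each residue modulo \<open>2 * n\<close>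
  once, and \<open>m\<close> is congruent to 1, so only \<open>j = 1\<close> responds. The increment
  of \<open>fourier m\<close> over one cell equals that of \<open>fourier 1\<close>, but the
  denominator keeps \<open>m\<close>, which makes the coefficient of size
  \<open>1 / m\<close>.\<close>

lemma discrete_kernel_fourier_coeff:
  assumes n: "n \<ge> 2" and x: "x \<in> grid n"
  defines "m \<equiv> 2 * int n + 1"
  shows "has_bochner_integral lborel
    (\<lambda>y. indicator {0..<1} y *\<^sub>R (discrete_kernel c n \<tau> x (rho n y) * fourier m y))
    (of_real ((1 + time_step c n * discrete_eigenvalue n 1) powr (\<tau> / time_step c n))
      * (2 * of_nat n * (fourier 1 (1 / (2 * real n)) - 1) / (2 * pi * \<i> * of_int m)) * fourier 1 x)"
proof -
  define q where "q j = (1 + time_step c n * discrete_eigenvalue n j) powr (\<tau> / time_step c n)" for j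
  define \<beta> where "\<beta> = 2 * of_nat n * (fourier m (1 / (2 * real n)) - 1) / (2 * pi * \<i> * of_int m)"
  have m: "m \<noteq> 0" using n by (simp add: m_def)
  have "has_bochner_integral lborel
     (\<lambda>y. \<Sum>j\<in>{- int n..int n - 1}. of_real (q j) * fourier j x * (indicator {0..<1} y *\<^sub>R (fourier (- j) (rho n y) * fourier m y)))
     (\<Sum>j\<in>{- int n..int n - 1}. of_real (q j) * fourier j x * (if 2 * int n dvd - j + m then \<beta> else 0))"
    unfolding \<beta>_def using n m
    by (intro has_bochner_integral_sum has_bochner_integral_mult_right rho_fourier_coeff) auto
  also have "(\<lambda>y. \<Sum>j\<in>{- int n..int n - 1}. of_real (q j) * fourier j x * (indicator {0..<1} y *\<^sub>R (fourier (- j) (rho n y) * fourier m y)))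
    = (\<lambda>y. indicator {0..<1} y *\<^sub>R (discrete_kernel c n \<tau> x (rho n y) * fourier m y))"
    by (simp add: discrete_kernel_def q_def fun_eq_iff sum_distrib_right sum_distrib_left fourier_diff scaleR_conv_of_real mult_ac)
  also have "(\<Sum>j\<in>{- int n..int n - 1}. of_real (q j) * fourier j x * (if 2 * int n dvd - j + m then \<beta> else 0))
    = (\<Sum>j\<in>{- int n..int n - 1}. if j = 1 then of_real (q j) * fourier j x * \<beta> else 0)"
  proof (intro sum.cong refl)
    fix j assume j: "j \<in> {- int n..int n - 1}"
    \<comment> \<open>For \<open>n \<ge> 2\<close> every \<open>\<bar>1 - j\<bar>\<close> is at most
      \<open>n + 1 < 2 * n\<close>, so divisibility forces it to be 0.\<close>
    have "2 * int n dvd - j + m \<longleftrightarrow> j = 1"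
    proof
      assume "2 * int n dvd - j + m"
      then have "2 * int n dvd (- j + m) - 2 * int n" by (rule dvd_diff) simp
      then have "2 * int n dvd 1 - j" by (simp add: m_def)
      with j n show "j = 1" using dvd_imp_le_int[of "1 - j" "2 * int n"] by fastforce
    qed (simp add: m_def)
    then show "of_real (q j) * fourier j x * (if 2 * int n dvd - j + m then \<beta> else 0)
      = (if j = 1 then of_real (q j) * fourier j x * \<beta> else 0)" by simp
  qed
  also have "\<dots> = of_real (q 1) * \<beta> * fourier 1 x"
    using n by simp
  also have "fourier m (1 / (2 * real n)) = fourier 1 (1 / (2 * real n))"
    using fourier_grid_periodic[of "1 / (2 * real n)" n 1 1] n by (simp add: m_def add.commute grid_def image_iff)
  then have "\<beta> = 2 * of_nat n * (fourier 1 (1 / (2 * real n)) - 1) / (2 * pi * \<i> * of_int m)" 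
    unfolding \<beta>_def by simp
  finally show ?thesis unfolding q_def .
qed

section \<open>Lower bound for the variance\<close>

text \<open>On the grid \<open>fourier m\<close> and \<open>fourier 1\<close> coincide, so both
  kernels contribute multiples of the same function of \<open>x\<close>, and the average against the
  cosine factors out as 1/2. The time \<open>\<tau>'\<close> is separate from \<open>\<tau>\<close>
  in order to become the rounded time \<open>kappa c n \<tau>\<close>.\<close>

lemma kernel_difference_fourier_coeff:
  fixes m :: int
  assumes n: "n \<ge> 2" and \<tau>: "\<tau> > 0" and m: "m = 2 * int n + 1"
  shows "has_bochner_integral lborel
    (\<lambda>y. indicator {0..<1} y *\<^sub>R ((\<Sum>x\<in>grid n. of_real (cos (2 * pi * x) / (2 * real n)) *
        (heat_kernel \<tau> x y - discrete_kernel c n \<tau>' x (rho n y))) * fourier m y))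
    ((of_real (exp (- 4 * pi\<^sup>2 * (of_int m)\<^sup>2 * \<tau>))
      - of_real ((1 + time_step c n * discrete_eigenvalue n 1) powr (\<tau>' / time_step c n))
        * (2 * of_nat n * (fourier 1 (1 / (2 * real n)) - 1) / (2 * pi * \<i> * of_int m))) / 2)"
    (is "has_bochner_integral _ _ ((?E - ?Q) / 2)")
proof -
  have eq: "indicator {0..<1} y *\<^sub>R ((\<Sum>x\<in>grid n. b x * (H x - K x)) * e) =
      (\<Sum>x\<in>grid n. b x * (indicator {0..<1} y *\<^sub>R (H x * e) - indicator {0..<1} y *\<^sub>R (K x * e)))"
    for b H K :: "real \<Rightarrow> complex" and e and y :: real
    by (cases "y \<in> {0..<1}") (simp_all add: sum_distrib_right left_diff_distrib right_diff_distrib mult.assoc)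
  have "has_bochner_integral lborel
     (\<lambda>y. \<Sum>x\<in>grid n. of_real (cos (2 * pi * x) / (2 * real n)) *
        (indicator {0..<1} y *\<^sub>R (heat_kernel \<tau> x y * fourier m y)
         - indicator {0..<1} y *\<^sub>R (discrete_kernel c n \<tau>' x (rho n y) * fourier m y)))
     (\<Sum>x\<in>grid n. of_real (cos (2 * pi * x) / (2 * real n)) * (?E * fourier m x - ?Q * fourier 1 x))"
    using n \<tau> unfolding m
    by (intro has_bochner_integral_sum has_bochner_integral_mult_right has_bochner_integral_diff
        heat_kernel_fourier_coeff discrete_kernel_fourier_coeff)
  also have "(\<Sum>x\<in>grid n. of_real (cos (2 * pi * x) / (2 * real n)) * (?E * fourier m x - ?Q * fourier 1 x))
     = (?E - ?Q) * (\<Sum>x\<in>grid n. of_real (cos (2 * pi * x) / (2 * real n)) * fourier 1 x)"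
    unfolding sum_distrib_left
  proof (intro sum.cong refl)
    fix x assume "x \<in> grid n"
    then have "fourier m x = fourier 1 x"
      using fourier_grid_periodic[of x n 1 1] by (simp add: m add.commute)
    then show "of_real (cos (2 * pi * x) / (2 * real n)) * (?E * fourier m x - ?Q * fourier 1 x)
      = (?E - ?Q) * (of_real (cos (2 * pi * x) / (2 * real n)) * fourier 1 x)"
      by (simp only: ring_distribs mult_ac)
  qed
  also have "(\<Sum>x\<in>grid n. of_real (cos (2 * pi * x) / (2 * real n)) * fourier 1 x) = 1 / 2"
    by (rule grid_fourier_cos_sum[OF n])
  also have "(?E - ?Q) * (1 / 2) = (?E - ?Q) / 2" by (simp only: mult_1_right times_divide_eq_right)
  finally show ?thesis
    unfolding eq .
qed

text \<open>Bessel's inequality for a single mode: Cauchy-Schwarz against the constant 1 on the unit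
  interval, with a character of modulus 1. With nonnegative integrals the right side may be
  infinite.\<close>

lemma nn_integral_power2_ge_fourier_coeff:
  assumes "has_bochner_integral lborel (\<lambda>y. indicator {0..<1} y *\<^sub>R (f y * fourier m y)) \<alpha>"
  shows "ennreal ((cmod \<alpha>)\<^sup>2) \<le> (\<integral>\<^sup>+ y. ennreal ((cmod (indicator {0..<1} y * f y))\<^sup>2) \<partial>lborel)"
proof -
  define G where "G = (\<lambda>y. indicator {0..<1} y *\<^sub>R (f y * fourier m y))"
  have int: "integrable lborel G" and \<alpha>: "integral\<^sup>L lborel G = \<alpha>"
    using assms unfolding G_def has_bochner_integral_iff by auto
  have [measurable]: "G \<in> borel_measurable borel"
    using borel_measurable_integrable[OF int] by simp
  have "ennreal (cmod \<alpha>) \<le> (\<integral>\<^sup>+ y. ennreal (cmod (G y)) \<partial>lborel)"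
    using integral_norm_bound_ennreal[OF int] by (simp add: \<alpha>)
  also have "\<dots> = (\<integral>\<^sup>+ y. ennreal (cmod (G y)) * indicator {0..<1} y \<partial>lborel)"
    by (intro nn_integral_cong) (simp add: G_def indicator_def)
  finally have "(ennreal (cmod \<alpha>))\<^sup>2 \<le> (\<integral>\<^sup>+ y. ennreal (cmod (G y)) * indicator {0..<1} y \<partial>lborel)\<^sup>2"
    by (intro power_mono) auto
  also have "\<dots> \<le> (\<integral>\<^sup>+ y. (ennreal (cmod (G y)))\<^sup>2 \<partial>lborel) * (\<integral>\<^sup>+ y. (indicator {0..<1::real} y)\<^sup>2 \<partial>lborel)"
    by (rule Cauchy_Schwarz_nn_integral[of "\<lambda>y. ennreal (cmod (G y))" lborel "indicator {0..<1}"]) auto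
  also have "(\<integral>\<^sup>+ y. (indicator {0..<1::real} y)\<^sup>2 \<partial>lborel) = (\<integral>\<^sup>+ y. indicator {0..<1::real} y \<partial>lborel)"
    by (intro nn_integral_cong) (simp add: indicator_def)
  also have "\<dots> = 1" by simp
  also have "(\<integral>\<^sup>+ y. (ennreal (cmod (G y)))\<^sup>2 \<partial>lborel)
      = (\<integral>\<^sup>+ y. ennreal ((cmod (indicator {0..<1} y * f y))\<^sup>2) \<partial>lborel)"
    by (intro nn_integral_cong) (simp add: G_def norm_mult ennreal_power indicator_def)
  finally show ?thesis by (simp add: ennreal_power)
qed

text \<open>One step of length \<open>h\<close> multiplies mode 1 by at least \<open>1 - p\<close>
  with \<open>p = 4 * pi\<^sup>2 * h\<close>, and \<open>1 - p \<ge> exp (- 2 * p)\<close> for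
  \<open>p \<le> 1 / 2\<close>. At most \<open>t / h\<close> steps therefore cost no more than
  \<open>exp (- 8 * pi\<^sup>2 * t)\<close>. This is twice the decay rate of the heat equation, but
  all that matters is a positive bound independent of \<open>n\<close>.\<close>

lemma discrete_symbol_lower_bound:
  assumes c: "0 < c" and n: "n \<ge> 1" and small: "c * pi\<^sup>2 / (real n)\<^sup>2 \<le> 1 / 2"
    and \<tau>: "0 \<le> \<tau>" "\<tau> \<le> t"
  shows "exp (- 8 * pi\<^sup>2 * t)
    \<le> (1 + time_step c n * discrete_eigenvalue n 1) powr (kappa c n \<tau> / time_step c n)"
proof -
  define p where "p = c * pi\<^sup>2 / (real n)\<^sup>2"
  have p: "0 < p" "p \<le> 1 / 2" using c n small by (auto simp: p_def)
  have h: "time_step c n > 0" using c n by (simp add: time_step_def)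
  have "(sin (pi / (2 * real n)))\<^sup>2 \<le> (pi / (2 * real n))\<^sup>2"
    using abs_sin_x_le_abs_x[of "pi / (2 * real n)"] by (simp add: power2_le_iff_abs_le abs_le_square_iff)
  then have "4 * c * (sin (pi / (2 * real n)))\<^sup>2 \<le> 4 * c * (pi / (2 * real n))\<^sup>2"
    using c by (intro mult_left_mono) auto
  moreover have "time_step c n * discrete_eigenvalue n 1 = - (4 * c * (sin (pi / (2 * real n)))\<^sup>2)"
    using n by (simp add: time_step_def discrete_eigenvalue_def field_simps)
  moreover have "4 * c * (pi / (2 * real n))\<^sup>2 = p" using n by (simp add: p_def field_simps power2_eq_square)
  ultimately have base: "1 - p \<le> 1 + time_step c n * discrete_eigenvalue n 1" by simp
  \<comment> \<open>The right side is \<open>1 + p * (1 - 2 * p)\<close>, which is where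
    \<open>p \<le> 1 / 2\<close> enters.\<close>
  have "1 * 1 \<le> (1 - p) * (1 + 2 * p)"
    using p mult_left_mono[of p "1/2" p] by (simp add: algebra_simps)
  also have "\<dots> \<le> (1 - p) * exp (2 * p)"
    using p exp_ge_add_one_self[of "2 * p"] by (intro mult_left_mono) auto
  finally have "exp (- 2 * p) \<le> 1 - p" by (simp add: exp_minus field_simps)
  with base have le: "exp (- 2 * p) \<le> 1 + time_step c n * discrete_eigenvalue n 1" by simp
  define r where "r = kappa c n \<tau> / time_step c n"
  have r: "r = of_int \<lfloor>\<tau> / time_step c n\<rfloor>" using h by (simp add: r_def kappa_def)
  have "\<tau> / time_step c n \<le> t / time_step c n" using h \<tau> by (intro divide_right_mono) auto
  then have r_le: "r \<le> t / time_step c n" unfolding r by linarith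
  have r_ge: "0 \<le> r" using h \<tau> unfolding r by simp
  have "- 8 * pi\<^sup>2 * t = - 2 * p * (t / time_step c n)"
    using c n by (simp add: p_def time_step_def field_simps power2_eq_square)
  also have "\<dots> \<le> - 2 * p * r" using p r_le by (intro mult_left_mono_neg) auto
  finally have "exp (- 8 * pi\<^sup>2 * t) \<le> exp (- 2 * p) powr r" by (simp add: powr_def mult_ac)
  also have "\<dots> \<le> (1 + time_step c n * discrete_eigenvalue n 1) powr r"
    using le r_ge by (intro powr_mono2) auto
  finally show ?thesis by (simp add: r_def)
qed

text \<open>The length of the chord of the unit circle over the angle \<open>pi / n\<close>.\<close>

lemma norm_fourier_increment:
  assumes "n \<ge> 1"
  shows "cmod (fourier 1 (1 / (2 * real n)) - 1) = 2 * sin (pi / (2 * real n))"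
proof -
  have "fourier 1 (1 / (2 * real n)) = exp (\<i> * of_real (pi / real n))"
    by (simp add: fourier_def field_simps)
  moreover have "sin (pi / (2 * real n)) \<ge> 0"
    using assms by (intro sin_ge_zero) (auto simp: field_simps)
  ultimately show ?thesis
    using dist_exp_i_1[of "pi / real n"] by (simp add: mult.commute)
qed

text \<open>For \<open>\<tau> \<ge> t / 2\<close> the heat term is exponentially small, so the
  discrete term, of order \<open>1 / n\<close>, decides. Uniformity in \<tau> lets one threshold for
  \<open>n\<close> serve all time slices.\<close>

lemma eventually_coefficient_lower_bound:
  assumes c: "0 < c" and t: "t > 0"
  shows "\<forall>\<^sub>F n in sequentially. \<forall>\<tau>\<in>{t / 2..t}. exp (- 8 * pi\<^sup>2 * t) / (24 * real n) \<le>
    cmod ((of_real (exp (- 4 * pi\<^sup>2 * (of_int (2 * int n + 1))\<^sup>2 * \<tau>))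
      - of_real ((1 + time_step c n * discrete_eigenvalue n 1) powr (kappa c n \<tau> / time_step c n))
        * (2 * of_nat n * (fourier 1 (1 / (2 * real n)) - 1) / (2 * pi * \<i> * of_int (2 * int n + 1)))) / 2)"
proof -
  define \<mu> where "\<mu> = exp (- 8 * pi\<^sup>2 * t)"
  have \<mu>: "\<mu> > 0" by (simp add: \<mu>_def)
  have "(\<lambda>n. c * pi\<^sup>2 / (real n)\<^sup>2) \<longlonglongrightarrow> 0" by real_asymp
  then have "\<forall>\<^sub>F n in sequentially. c * pi\<^sup>2 / (real n)\<^sup>2 < 1 / 2"
    by (rule order_tendstoD) simp
  moreover have "(\<lambda>n. 2 * real n / pi * sin (pi / (2 * real n))) \<longlonglongrightarrow> 1"
    by real_asymp
  then have "\<forall>\<^sub>F n in sequentially. 1 / 2 < 2 * real n / pi * sin (pi / (2 * real n))"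
    by (rule order_tendstoD) simp
  moreover have "(\<lambda>n. exp (- 2 * pi\<^sup>2 * t * (2 * real n + 1)\<^sup>2) * (2 * real n + 1)) \<longlonglongrightarrow> 0"
    using t by real_asymp
  then have "\<forall>\<^sub>F n in sequentially. exp (- 2 * pi\<^sup>2 * t * (2 * real n + 1)\<^sup>2) * (2 * real n + 1) < \<mu> / 4"
    using \<mu> by (intro order_tendstoD) auto
  ultimately show ?thesis
    using eventually_ge_at_top[of 1]
  proof eventually_elim
    case (elim n)
    show ?case
    proof
      fix \<tau> assume \<tau>: "\<tau> \<in> {t / 2..t}"
      define q where "q = (1 + time_step c n * discrete_eigenvalue n 1) powr (kappa c n \<tau> / time_step c n)"
      define E where "E = exp (- 4 * pi\<^sup>2 * (real_of_int (2 * int n + 1))\<^sup>2 * \<tau>)"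
      define \<beta> where "\<beta> = 2 * of_nat n * (fourier 1 (1 / (2 * real n)) - 1) / (2 * pi * \<i> * of_int (2 * int n + 1))"
      have q: "\<mu> \<le> q"
        unfolding \<mu>_def q_def using elim \<tau> c t by (intro discrete_symbol_lower_bound) auto
      have "cmod (of_int (2 * int n + 1)) = 2 * real n + 1" by (simp only: norm_of_int)
      then have "cmod \<beta> = 2 * real n * (2 * sin (pi / (2 * real n))) / (2 * pi * (2 * real n + 1))"
        using elim by (simp add: \<beta>_def norm_mult norm_divide norm_fourier_increment)
      also have "\<dots> = (2 * real n / pi * sin (pi / (2 * real n))) / (2 * real n + 1)"
        by (simp add: divide_simps)
      also have "\<dots> \<ge> (1 / 2) / (2 * real n + 1)"
        using elim by (intro divide_right_mono) auto
      finally have \<beta>: "(1 / 2) / (2 * real n + 1) \<le> cmod \<beta>" .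
      have "(2 * pi\<^sup>2 * (2 * real n + 1)\<^sup>2) * t \<le> (2 * pi\<^sup>2 * (2 * real n + 1)\<^sup>2) * (2 * \<tau>)"
        using \<tau> by (intro mult_left_mono) auto
      then have "E \<le> exp (- 2 * pi\<^sup>2 * t * (2 * real n + 1)\<^sup>2)"
        by (simp add: E_def algebra_simps)
      also have "\<dots> \<le> (\<mu> / 4) / (2 * real n + 1)"
        using elim by (simp add: field_simps)
      finally have E: "E \<le> (\<mu> / 4) / (2 * real n + 1)" .
      \<comment> \<open>Up to the common denominator \<open>2 * n + 1\<close>, the discrete term is
        at least \<open>\<mu> / 2\<close> and the heat term at most \<open>\<mu> / 4\<close>. The
        remaining \<open>\<mu> / 4\<close> is halved by the weight 1/2 of the cosine
        average.\<close>
      have "\<mu> * ((1 / 2) / (2 * real n + 1)) \<le> q * cmod \<beta>"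
        using q \<beta> \<mu> by (intro mult_mono) auto
      also have "\<dots> = cmod (of_real q * \<beta>)"
        using q \<mu> by (simp add: norm_mult)
      also have "\<dots> \<le> cmod (of_real E - of_real q * \<beta>) + E"
        using norm_triangle_ineq2[of "of_real q * \<beta>" "of_real E"]
        by (simp add: norm_minus_commute E_def)
      finally have "\<mu> * ((1 / 2) / (2 * real n + 1)) - (\<mu> / 4) / (2 * real n + 1) \<le> cmod (of_real E - of_real q * \<beta>)"
        using E by simp
      also have "\<mu> * ((1 / 2) / (2 * real n + 1)) - (\<mu> / 4) / (2 * real n + 1) = \<mu> / (4 * (2 * real n + 1))"
        by (simp add: divide_simps)
      finally have "\<mu> / (4 * (2 * real n + 1)) / 2 \<le> cmod (of_real E - of_real q * \<beta>) / 2"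
        by (rule divide_right_mono) simp
      then have "\<mu> / (8 * (2 * real n + 1)) \<le> cmod ((of_real E - of_real q * \<beta>) / 2)"
        by (simp only: norm_divide norm_numeral divide_divide_eq_left mult_ac)
      \<comment> \<open>From \<open>2 * n + 1 \<le> 3 * n\<close>.\<close>
      moreover have "\<mu> / (24 * real n) \<le> \<mu> / (8 * (2 * real n + 1))"
        using elim \<mu> by (intro divide_left_mono) auto
      ultimately show "exp (- 8 * pi\<^sup>2 * t) / (24 * real n) \<le>
          cmod ((of_real (exp (- 4 * pi\<^sup>2 * (of_int (2 * int n + 1))\<^sup>2 * \<tau>))
      - of_real ((1 + time_step c n * discrete_eigenvalue n 1) powr (kappa c n \<tau> / time_step c n))
        * (2 * of_nat n * (fourier 1 (1 / (2 * real n)) - 1) / (2 * pi * \<i> * of_int (2 * int n + 1)))) / 2)"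
        unfolding E_def q_def \<beta>_def \<mu>_def by simp
    qed
  qed
qed

section \<open>From time slices to the full variance, and conclusion\<close>

text \<open>Tonelli's theorem, keeping only the slices that the noise enters early enough for the
  heat kernel to have smoothed for a time of at least \<open>t / 2\<close>.\<close>

lemma nn_integral_power2_ge_slices:
  fixes F :: "real \<times> real \<Rightarrow> complex"
  assumes F: "F \<in> borel_measurable borel" and t: "t > 0" and L: "L \<ge> 0"
    and slice: "\<And>s. s \<in> {0..t / 2} \<Longrightarrow> ennreal L \<le> (\<integral>\<^sup>+ y. ennreal ((cmod (F (s, y)))\<^sup>2) \<partial>lborel)"
  shows "ennreal (t / 2 * L) \<le> (\<integral>\<^sup>+ z. ennreal ((cmod (F z))\<^sup>2) \<partial>(lborel :: (real \<times> real) measure))"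
proof -
  have meas: "(\<lambda>z. ennreal ((cmod (F z))\<^sup>2)) \<in> borel_measurable (lborel \<Otimes>\<^sub>M lborel)"
    using F by (simp add: lborel_prod)
  have "ennreal (t / 2 * L) = (\<integral>\<^sup>+ s. ennreal L * indicator {0..t / 2} s \<partial>lborel)"
    using t L by (simp add: nn_integral_cmult_indicator ennreal_mult[symmetric] mult.commute)
  also have "\<dots> \<le> (\<integral>\<^sup>+ s. (\<integral>\<^sup>+ y. ennreal ((cmod (F (s, y)))\<^sup>2) \<partial>lborel) \<partial>lborel)"
    using slice by (intro nn_integral_mono) (auto simp: indicator_def)
  also have "\<dots> = (\<integral>\<^sup>+ z. ennreal ((cmod (F z))\<^sup>2) \<partial>(lborel \<Otimes>\<^sub>M lborel))"
    by (rule lborel.nn_integral_fst[OF meas])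
  finally show ?thesis by (simp add: lborel_prod)
qed

text \<open>Both fields are real, so only the real part of the conjugated character, a cosine,
  contributes.\<close>

lemma Re_grid_inner:
  "Re (grid_inner n (\<lambda>x. grid_restrict n (\<lambda>x. complex_of_real (f x)) x - complex_of_real (g x))
      (grid_restrict n (fourier 1)))
    = (\<Sum>x\<in>grid n. cos (2 * pi * x) / (2 * real n) * (f x - g x))"
proof -
  have "Re (grid_inner n (\<lambda>x. grid_restrict n (\<lambda>x. complex_of_real (f x)) x - complex_of_real (g x))
      (grid_restrict n (fourier 1)))
    = Re (of_real (1 / (2 * real n)) * (\<Sum>x\<in>grid n. of_real (f x - g x) * cnj (fourier 1 x)))"
    by (simp add: grid_inner_def grid_restrict_def)
  also have "\<dots> = (\<Sum>x\<in>grid n. cos (2 * pi * x) / (2 * real n) * (f x - g x))"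
    unfolding times_complex.sel(1) by (simp add: sum_distrib_left fourier_eq_cis mult_ac)
  finally show ?thesis .
qed

theorem proposition1p11:
  fixes P :: "'w measure"
    and \<xi> :: "(real \<times> real) set \<Rightarrow> 'w \<Rightarrow> real"
    and u :: "real \<Rightarrow> real \<Rightarrow> 'w \<Rightarrow> real"
    and un :: "nat \<Rightarrow> real \<Rightarrow> real \<Rightarrow> 'w \<Rightarrow> real"
    and c \<epsilon> t :: real
  assumes "prob_space P" and "complete_measure P"
    and "white_noise P \<xi>"
    and "0 < c" and "c < 1/4"
    and "mild_solution P \<xi> u"
    and "\<And>n. n \<ge> 1 \<Longrightarrow> fd_approximation P \<xi> c n (un n)"
    and "\<epsilon> > 0" and "t > 0"
  shows "\<forall>K>0.
    (\<lambda>n. measure P {\<omega> \<in> space P.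
       real n powr (1 + \<epsilon>) *
         cmod (grid_inner n
           (\<lambda>x. grid_restrict n (\<lambda>x. complex_of_real (u t x \<omega>)) x - complex_of_real (un n t x \<omega>))
           (grid_restrict n (fourier 1))) > K})
    \<longlonglongrightarrow> 1"
proof (intro allI impI)
  fix K :: real assume K: "K > 0"
  interpret prob_space P by fact
  note t = \<open>t > 0\<close>
  define Z where "Z n \<omega> = grid_inner n
           (\<lambda>x. grid_restrict n (\<lambda>x. complex_of_real (u t x \<omega>)) x - complex_of_real (un n t x \<omega>))
           (grid_restrict n (fourier 1))" for n \<omega>
  define b where "b n x = cos (2 * pi * x) / (2 * real n)" for n x
  define X where "X n \<omega> = (\<Sum>x\<in>grid n. b n x * (u t x \<omega> - un n t x \<omega>))" for n \<omega>
  \<comment> \<open>The difference is written as a sum with \<open>- 1\<close> times the second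
    kernel, the shape that closure under sums and scalar multiples produces.\<close>
  define f where "f n = (\<lambda>z. \<Sum>x\<in>grid n. complex_of_real (b n x) *
     ((case z of (s, y) \<Rightarrow> indicator ({0..<t} \<times> {0..<1}) (s, y) * heat_kernel (t - s) x y)
      + - 1 * (case z of (s, y) \<Rightarrow> indicator ({0..<t} \<times> {0..<1}) (s, y)
             * discrete_kernel c n (kappa c n (t - s)) x (rho n y))))" for n
  \<comment> \<open>Chosen so that \<open>(D / n)\<^sup>2\<close> is \<open>t / 2\<close>, the
    length of the retained time interval, times the squared coefficient bound on each slice.\<close>
  define D where "D = sqrt (t / 2) * (exp (- 8 * pi\<^sup>2 * t) / 24)"
  have D: "D > 0" using t by (simp add: D_def)
  have ReZ: "Re (Z n \<omega>) = X n \<omega>" for n \<omega>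
    unfolding Z_def X_def b_def by (rule Re_grid_inner)
  have grid: "x \<in> {0..<1}" if "x \<in> grid n" for x n
    using that by (auto simp: grid_def divide_simps)
  have u_wiener: "wiener_integral P \<xi>
      (\<lambda>(s, y). indicator ({0..<t} \<times> {0..<1}) (s, y) * heat_kernel (t - s) x y)
      (\<lambda>\<omega>. complex_of_real (u t x \<omega>))" if "x \<in> grid n" for x n
    using assms(6) t grid[OF that] unfolding mild_solution_def by simp
  have un_wiener: "wiener_integral P \<xi>
      (\<lambda>(s, y). indicator ({0..<t} \<times> {0..<1}) (s, y)
             * discrete_kernel c n (kappa c n (t - s)) x (rho n y))
      (\<lambda>\<omega>. complex_of_real (un n t x \<omega>))" if "x \<in> grid n" "n \<ge> 1" for x n
    using assms(7)[OF that(2)] t that(1) unfolding fd_approximation_def by simp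
  have X_wiener: "wiener_integral P \<xi> (f n) (\<lambda>\<omega>. complex_of_real (X n \<omega>))" if "n \<ge> 1" for n
  proof -
    have "wiener_integral P \<xi> (f n)
       (\<lambda>\<omega>. \<Sum>x\<in>grid n. complex_of_real (b n x) * (complex_of_real (u t x \<omega>) + - 1 * complex_of_real (un n t x \<omega>)))"
      unfolding f_def using assms(3) u_wiener un_wiener that
      by (intro wiener_integral_sum wiener_integral_add wiener_integral_cmult) auto
    then show ?thesis by (simp add: X_def)
  qed
  \<comment> \<open>The radius is quantified inside, because it will depend on
    \<open>n\<close>.\<close>
  have X_small: "\<forall>\<^sub>F n in sequentially. \<forall>\<delta>>0. prob {\<omega> \<in> space P. \<bar>X n \<omega>\<bar> \<le> \<delta>} \<le> 4 * \<delta> / (D / real n)"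
    using eventually_coefficient_lower_bound[OF \<open>0 < c\<close> t] eventually_ge_at_top[of 2]
  proof eventually_elim
    case (elim n)
    define L where "L = exp (- 8 * pi\<^sup>2 * t) / (24 * real n)"
    have L: "L > 0" using elim(2) by (simp add: L_def)
    have "ennreal (t / 2 * L\<^sup>2) \<le> (\<integral>\<^sup>+ z. ennreal ((cmod (f n z))\<^sup>2) \<partial>lborel)"
    proof (rule nn_integral_power2_ge_slices)
      show "f n \<in> borel_measurable borel"
        using X_wiener[of n] elim(2) unfolding wiener_integral_def by simp
      fix s assume s: "s \<in> {0..t / 2}"
      define \<tau> where "\<tau> = t - s"
      have \<tau>: "\<tau> \<in> {t / 2..t}" "\<tau> > 0" using s t by (auto simp: \<tau>_def)
      define F where "F y = (\<Sum>x\<in>grid n. of_real (b n x) *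
        (heat_kernel \<tau> x y - discrete_kernel c n (kappa c n \<tau>) x (rho n y)))" for y
      \<comment> \<open>As \<open>s \<le> t / 2 < t\<close>, the time indicator is 1 and only the
        spatial one remains.\<close>
      have f_eq: "f n (s, y) = indicator {0..<1} y * F y" for y
        using s t by (cases "y \<in> {0..<1}") (simp_all add: f_def F_def \<tau>_def)
      note coeff = kernel_difference_fourier_coeff[OF elim(2) \<tau>(2) refl, of c "kappa c n \<tau>"]
      have "ennreal (L\<^sup>2) \<le> ennreal ((cmod ((of_real (exp (- 4 * pi\<^sup>2 * (of_int (2 * int n + 1))\<^sup>2 * \<tau>))
      - of_real ((1 + time_step c n * discrete_eigenvalue n 1) powr (kappa c n \<tau> / time_step c n))
        * (2 * of_nat n * (fourier 1 (1 / (2 * real n)) - 1) / (2 * pi * \<i> * of_int (2 * int n + 1)))) / 2))\<^sup>2)"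
        using elim(1) \<tau>(1) L unfolding L_def by (intro ennreal_leI power_mono) auto
      also have "\<dots> \<le> (\<integral>\<^sup>+ y. ennreal ((cmod (indicator {0..<1} y * F y))\<^sup>2) \<partial>lborel)"
        unfolding F_def b_def by (rule nn_integral_power2_ge_fourier_coeff[OF coeff])
      finally show "ennreal (L\<^sup>2) \<le> (\<integral>\<^sup>+ y. ennreal ((cmod (f n (s, y)))\<^sup>2) \<partial>lborel)"
        by (simp add: f_eq)
    qed (use t in auto)
    moreover have "t / 2 * L\<^sup>2 = (D / real n)\<^sup>2"
      using t by (simp add: D_def L_def power_mult_distrib power_divide)
    ultimately have "ennreal ((D / real n)\<^sup>2) \<le> (\<integral>\<^sup>+ z. ennreal ((cmod (f n z))\<^sup>2) \<partial>lborel)" by simp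
    then show ?case
      using X_wiener[of n] elim(2) D by (intro allI impI wiener_integral_small_ball[OF assms(3)]) auto
  qed
  have meas: "u t x \<in> borel_measurable P" "n \<ge> 1 \<Longrightarrow> un n t x \<in> borel_measurable P" if "x \<in> grid n" for n x
  proof -
    have "(\<lambda>\<omega>. Re (complex_of_real (u t x \<omega>))) \<in> borel_measurable P"
      using u_wiener[OF that] unfolding wiener_integral_def by (intro borel_measurable_Re[THEN measurable_compose[rotated]]) auto
    then show "u t x \<in> borel_measurable P" by simp
    assume "n \<ge> 1"
    then have "(\<lambda>\<omega>. Re (complex_of_real (un n t x \<omega>))) \<in> borel_measurable P"
      using un_wiener[OF that] unfolding wiener_integral_def by (intro borel_measurable_Re[THEN measurable_compose[rotated]]) auto
    then show "un n t x \<in> borel_measurable P" by simp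
  qed
  \<comment> \<open>A non-measurable set has measure 0 by default, so the inclusion of events below
    yields an inequality only once the larger event is known to be measurable.\<close>
  have Z_meas: "Z n \<in> borel_measurable P" if "n \<ge> 1" for n
    unfolding Z_def grid_inner_def using meas that
    by (intro borel_measurable_times borel_measurable_const borel_measurable_sum)
       (auto simp: grid_restrict_def intro!: borel_measurable_diff borel_measurable_of_real)
  have lower: "\<forall>\<^sub>F n in sequentially. 1 - 4 * K / D * real n powr (- \<epsilon>)
      \<le> prob {\<omega> \<in> space P. K < real n powr (1 + \<epsilon>) * cmod (Z n \<omega>)}"
    using X_small eventually_ge_at_top[of 1]
  proof eventually_elim
    case (elim n)
    note [measurable] = Z_meas[OF elim(2)]
    \<comment> \<open>The threshold for the unscaled variable. Divided by the standard deviation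
      bound \<open>D / n\<close>, it loses one power of \<open>n\<close>, and just the power
      \<open>- \<epsilon>\<close> is left to drive the probability to 0.\<close>
    define \<delta> where "\<delta> = K * real n powr - (1 + \<epsilon>)"
    have \<delta>: "\<delta> > 0" using K elim(2) by (simp add: \<delta>_def)
    have X_meas [measurable]: "X n \<in> borel_measurable P"
      unfolding ReZ[symmetric] by measurable
    have "4 * \<delta> / (D / real n) = 4 * K / D * (real n powr - (1 + \<epsilon>) * real n powr 1)"
      using elim(2) by (simp add: \<delta>_def)
    also have "real n powr - (1 + \<epsilon>) * real n powr 1 = real n powr (- \<epsilon>)"
      by (simp only: powr_add[symmetric]) simp
    finally have "prob {\<omega> \<in> space P. \<bar>X n \<omega>\<bar> \<le> \<delta>} \<le> 4 * K / D * real n powr (- \<epsilon>)"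
      using elim(1) \<delta> by metis
    then have "1 - 4 * K / D * real n powr (- \<epsilon>) \<le> 1 - prob {\<omega> \<in> space P. \<bar>X n \<omega>\<bar> \<le> \<delta>}"
      by simp
    also have "\<dots> = prob {\<omega> \<in> space P. \<not> \<bar>X n \<omega>\<bar> \<le> \<delta>}"
      by (intro prob_neg[symmetric]) measurable
    also have "\<dots> \<le> prob {\<omega> \<in> space P. K < real n powr (1 + \<epsilon>) * cmod (Z n \<omega>)}"
    proof (intro finite_measure_mono subsetI)
      fix \<omega> assume \<omega>: "\<omega> \<in> {\<omega> \<in> space P. \<not> \<bar>X n \<omega>\<bar> \<le> \<delta>}"
      have "\<delta> < cmod (Z n \<omega>)"
        using \<omega> abs_Re_le_cmod[of "Z n \<omega>"] by (simp add: ReZ)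
      then have "real n powr (1 + \<epsilon>) * \<delta> < real n powr (1 + \<epsilon>) * cmod (Z n \<omega>)"
        using elim(2) by (intro mult_strict_left_mono) auto
      moreover have "real n powr (1 + \<epsilon>) * \<delta> = K"
        using elim(2) unfolding \<delta>_def powr_minus by simp
      ultimately show "\<omega> \<in> {\<omega> \<in> space P. K < real n powr (1 + \<epsilon>) * cmod (Z n \<omega>)}"
        using \<omega> by simp
    qed measurable
    finally show ?case .
  qed
  have "(\<lambda>n. 1 - 4 * K / D * real n powr (- \<epsilon>)) \<longlonglongrightarrow> 1 - 4 * K / D * 0"
    using \<open>\<epsilon> > 0\<close> by (intro tendsto_intros tendsto_neg_powr filterlim_real_sequentially) auto
  then have "(\<lambda>n. 1 - 4 * K / D * real n powr (- \<epsilon>)) \<longlonglongrightarrow> 1" by simp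
  then show "(\<lambda>n. prob {\<omega> \<in> space P. K < real n powr (1 + \<epsilon>) * cmod (Z n \<omega>)}) \<longlonglongrightarrow> 1"
    by (intro tendsto_sandwich[OF lower _ _ tendsto_const]) simp_all
qed

end
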